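(* Let $P : A \to A$ be a real completely positive completely contractive map (resp. projection) on an operator algebra $A$ (possibly with no kind of approximate identity). There exists a largest approximately unital subalgebra $D$ of $A$, and it is a hereditary subalgebra of $A$. Moreover, $P(D) \subset D$, and the restriction $P'$ of $P$ to $D$ is a real completely positive completely contractive map (resp. projection) on $D$. In addition, $P'$ is completely bicontractive (resp. completely symmetric) if $P$ has the same property.
   Context: An operator algebra is a norm-closed, not necessarily selfadjoint, subalgebra of $B(H)$ for a Hilbert space $H$, with its inherited operator space structure; subalgebras are closed. It is approximately unital if it has a contractive approximate identity. A hereditary subalgebra of $A$ is an approximately unital subalgebra $D$ with $DAD \subset D$. A map on $A$ is a linear map $A \to A$, and a projection on $A$ is a linear idempotent map $A \to A$; a projection $P$ is completely bicontractive if $P$ and $I-P$ are completely contractive, and completely symmetric if $\|I-2P\|_{\rm cb} \leq 1$. Write $\mathfrak{r}_A = \{x \in A : x + x^* \geq 0\}$; a linear map $P$ on $A$ is real completely positive if $P_n(\mathfrak{r}_{M_n(A)}) \subset \mathfrak{r}_{M_n(A)}$ for all $n \in \mathbb{N}$, where $P_n$ is the amplification to $M_n(A)$. *)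

theory Defs
  imports "HOL-Analysis.Analysis" "HOL-Library.Complex_Order"
begin

section \<open>Complex Hilbert spaces\<close>

text \<open>
  A complex Hilbert space is presented as a real Hilbert space with a compatible complex
  structure: the real inner product (hence the norm and the topology) is the real part of
  the complex one, which is linear in its first argument.
\<close>

class complex_hilbert_space = real_inner + complete_space +
  fixes scaleC :: "complex \<Rightarrow> 'a \<Rightarrow> 'a"  (infixr \<open>*\<^sub>C\<close> 75)
    and cinner :: "'a \<Rightarrow> 'a \<Rightarrow> complex"
  assumes scaleC_add_right: "c *\<^sub>C (x + y) = c *\<^sub>C x + c *\<^sub>C y"
    and scaleC_add_left: "(c + d) *\<^sub>C x = c *\<^sub>C x + d *\<^sub>C x"
    and scaleC_scaleC: "c *\<^sub>C d *\<^sub>C x = (c * d) *\<^sub>C x"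
    and scaleC_of_real: "complex_of_real r *\<^sub>C x = r *\<^sub>R x"
    and cinner_commute: "cinner x y = cnj (cinner y x)"
    and cinner_add_left: "cinner (x + y) z = cinner x z + cinner y z"
    and cinner_scaleC_left: "cinner (c *\<^sub>C x) y = c * cinner x y"
    and Re_cinner: "Re (cinner x y) = inner x y"

instantiation complex :: complex_hilbert_space
begin
definition "c *\<^sub>C (x::complex) = c * x"
definition "cinner x (y::complex) = x * cnj y"
instance
  by standard (simp_all add: scaleC_complex_def cinner_complex_def algebra_simps
      scaleR_conv_of_real inner_complex_def)
end

lemma cinner_scaleC_right: "cinner x (c *\<^sub>C y) = cnj c * cinner x y"
  by (metis cinner_commute cinner_scaleC_left complex_cnj_mult)

lemma norm_scaleC: "norm (c *\<^sub>C x) = cmod c * norm x"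
  for x :: "'a::complex_hilbert_space"
proof -
  have "cinner (c *\<^sub>C x) (c *\<^sub>C x) = complex_of_real ((cmod c)\<^sup>2) * cinner x x"
    by (simp add: cinner_scaleC_left cinner_scaleC_right complex_norm_square mult.commute
        mult.left_commute del: of_real_power)
  then have "inner (c *\<^sub>C x) (c *\<^sub>C x) = (cmod c)\<^sup>2 * inner x x"
    by (simp flip: Re_cinner del: of_real_power)
  then show ?thesis
    by (simp add: norm_eq_sqrt_inner real_sqrt_mult)
qed

section \<open>Bounded operators and their matrices\<close>

text \<open>
  The library type of bounded linear operators consists of the real-linear ones; $B(H)$ is
  the set of complex-linear operators among them, with the same operator norm.
\<close>

definition bounded_operators :: "('h::complex_hilbert_space \<Rightarrow>\<^sub>L 'h) set" where
  "bounded_operators = {T. \<forall>c \<xi>. blinfun_apply T (c *\<^sub>C \<xi>) = c *\<^sub>C blinfun_apply T \<xi>}"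

lift_definition scaleC_op ::
  "complex \<Rightarrow> ('h::complex_hilbert_space \<Rightarrow>\<^sub>L 'h) \<Rightarrow> ('h \<Rightarrow>\<^sub>L 'h)"
  is "\<lambda>c T \<xi>. c *\<^sub>C T \<xi>"
proof -
  fix c and T :: "'h \<Rightarrow> 'h"
  assume T: "bounded_linear T"
  have "bounded_linear (\<lambda>\<xi>::'h. c *\<^sub>C \<xi>)"
  proof (rule bounded_linear_intro)
    show "c *\<^sub>C (r *\<^sub>R \<xi>) = r *\<^sub>R c *\<^sub>C \<xi>" for r and \<xi> :: 'h
      by (metis mult.commute scaleC_of_real scaleC_scaleC)
    show "norm (c *\<^sub>C \<xi>) \<le> norm \<xi> * cmod c" for \<xi> :: 'h
      by (simp add: norm_scaleC)
  qed (simp add: scaleC_add_right)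
  then show "bounded_linear (\<lambda>\<xi>. c *\<^sub>C T \<xi>)"
    using T by (rule bounded_linear_compose)
qed

definition op_adjoint ::
  "('h::complex_hilbert_space \<Rightarrow>\<^sub>L 'h) \<Rightarrow> ('h \<Rightarrow>\<^sub>L 'h)" where
  "op_adjoint T = (THE S. \<forall>\<xi> \<eta>. cinner (blinfun_apply T \<xi>) \<eta> = cinner \<xi> (blinfun_apply S \<eta>))"

text \<open>
  An $n \times n$ matrix of operators is a function of two indices of which only the values
  at indices below $n$ matter; it acts on $H^n$, whose elements are likewise sequences read
  below $n$.  The degenerate size $n = 0$ is harmless: it contributes norm $0$ and an empty
  positivity condition.
\<close>

type_synonym 'h op_matrix = "nat \<Rightarrow> nat \<Rightarrow> ('h \<Rightarrow>\<^sub>L 'h)"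

definition matrices ::
  "nat \<Rightarrow> ('h::complex_hilbert_space \<Rightarrow>\<^sub>L 'h) set \<Rightarrow> 'h op_matrix set" where
  "matrices n A = {x. \<forall>i<n. \<forall>j<n. x i j \<in> A}"

definition matrix_apply ::
  "nat \<Rightarrow> 'h::complex_hilbert_space op_matrix \<Rightarrow> (nat \<Rightarrow> 'h) \<Rightarrow> nat \<Rightarrow> 'h" where
  "matrix_apply n x \<xi> = (\<lambda>i. \<Sum>j<n. blinfun_apply (x i j) (\<xi> j))"

definition matrix_norm :: "nat \<Rightarrow> 'h::complex_hilbert_space op_matrix \<Rightarrow> real" where
  "matrix_norm n x =
     (SUP \<xi>\<in>{\<xi>. L2_set (\<lambda>j. norm (\<xi> j)) {..<n} \<le> 1}.
        L2_set (\<lambda>i. norm (matrix_apply n x \<xi> i)) {..<n})"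

definition matrix_adjoint ::
  "'h::complex_hilbert_space op_matrix \<Rightarrow> 'h op_matrix" where
  "matrix_adjoint x = (\<lambda>i j. op_adjoint (x j i))"

definition matrix_nonneg :: "nat \<Rightarrow> 'h::complex_hilbert_space op_matrix \<Rightarrow> bool" where
  "matrix_nonneg n x \<longleftrightarrow> (\<forall>\<xi>. 0 \<le> (\<Sum>i<n. cinner (matrix_apply n x \<xi> i) (\<xi> i)))"

text \<open>\<open>accretive n A\<close> is $\mathfrak{r}_{M_n(A)}$.\<close>

definition accretive ::
  "nat \<Rightarrow> ('h::complex_hilbert_space \<Rightarrow>\<^sub>L 'h) set \<Rightarrow> 'h op_matrix set" where
  "accretive n A =
     {x \<in> matrices n A. matrix_nonneg n (\<lambda>i j. x i j + matrix_adjoint x i j)}"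

section \<open>Operator algebras\<close>

definition operator_algebra :: "('h::complex_hilbert_space \<Rightarrow>\<^sub>L 'h) set \<Rightarrow> bool" where
  "operator_algebra A \<longleftrightarrow>
     A \<subseteq> bounded_operators \<and> closed A \<and> 0 \<in> A \<and>
     (\<forall>S\<in>A. \<forall>T\<in>A. S + T \<in> A) \<and> (\<forall>c. \<forall>T\<in>A. scaleC_op c T \<in> A) \<and>
     (\<forall>S\<in>A. \<forall>T\<in>A. S o\<^sub>L T \<in> A)"

text \<open>
  A contractive approximate identity is a net; as usual in the library, the net is replaced
  by a proper filter on the operators (the filter of its tails).
\<close>

definition approximately_unital :: "('h::complex_hilbert_space \<Rightarrow>\<^sub>L 'h) set \<Rightarrow> bool" where
  "approximately_unital D \<longleftrightarrow>
     (\<exists>F. F \<noteq> bot \<and> (\<forall>\<^sub>F e in F. e \<in> D \<and> norm e \<le> 1) \<and>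
       (\<forall>a\<in>D. ((\<lambda>e. e o\<^sub>L a) \<longlongrightarrow> a) F \<and> ((\<lambda>e. a o\<^sub>L e) \<longlongrightarrow> a) F))"

definition approximately_unital_subalgebra ::
  "('h::complex_hilbert_space \<Rightarrow>\<^sub>L 'h) set \<Rightarrow> ('h \<Rightarrow>\<^sub>L 'h) set \<Rightarrow> bool" where
  "approximately_unital_subalgebra A D \<longleftrightarrow>
     D \<subseteq> A \<and> operator_algebra D \<and> approximately_unital D"

definition hereditary_subalgebra ::
  "('h::complex_hilbert_space \<Rightarrow>\<^sub>L 'h) set \<Rightarrow> ('h \<Rightarrow>\<^sub>L 'h) set \<Rightarrow> bool" where
  "hereditary_subalgebra A D \<longleftrightarrow>
     approximately_unital_subalgebra A D \<and>
     (\<forall>d\<in>D. \<forall>a\<in>A. \<forall>e\<in>D. d o\<^sub>L a o\<^sub>L e \<in> D)"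

definition largest_approximately_unital_subalgebra ::
  "('h::complex_hilbert_space \<Rightarrow>\<^sub>L 'h) set \<Rightarrow> ('h \<Rightarrow>\<^sub>L 'h) set \<Rightarrow> bool" where
  "largest_approximately_unital_subalgebra A D \<longleftrightarrow>
     approximately_unital_subalgebra A D \<and>
     (\<forall>E. approximately_unital_subalgebra A E \<longrightarrow> E \<subseteq> D)"

section \<open>Maps on an operator algebra\<close>

text \<open>
  A map on \<open>A\<close> is a function on all operators of which only the values on \<open>A\<close> matter.
\<close>

definition map_on ::
  "('h::complex_hilbert_space \<Rightarrow>\<^sub>L 'h) set \<Rightarrow> (('h \<Rightarrow>\<^sub>L 'h) \<Rightarrow> ('h \<Rightarrow>\<^sub>L 'h)) \<Rightarrow> bool" where
  "map_on A P \<longleftrightarrow>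
     (\<forall>T\<in>A. P T \<in> A) \<and> (\<forall>S\<in>A. \<forall>T\<in>A. P (S + T) = P S + P T) \<and>
     (\<forall>c. \<forall>T\<in>A. P (scaleC_op c T) = scaleC_op c (P T))"

definition projection_on ::
  "('h::complex_hilbert_space \<Rightarrow>\<^sub>L 'h) set \<Rightarrow> (('h \<Rightarrow>\<^sub>L 'h) \<Rightarrow> ('h \<Rightarrow>\<^sub>L 'h)) \<Rightarrow> bool" where
  "projection_on A P \<longleftrightarrow> map_on A P \<and> (\<forall>T\<in>A. P (P T) = P T)"

definition amplification ::
  "(('h::complex_hilbert_space \<Rightarrow>\<^sub>L 'h) \<Rightarrow> ('h \<Rightarrow>\<^sub>L 'h)) \<Rightarrow> 'h op_matrix \<Rightarrow> 'h op_matrix" where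
  "amplification P x = (\<lambda>i j. P (x i j))"

definition cb_norm ::
  "('h::complex_hilbert_space \<Rightarrow>\<^sub>L 'h) set \<Rightarrow> (('h \<Rightarrow>\<^sub>L 'h) \<Rightarrow> ('h \<Rightarrow>\<^sub>L 'h)) \<Rightarrow> ennreal" where
  "cb_norm A P =
     (SUP n. SUP x\<in>{x \<in> matrices n A. matrix_norm n x \<le> 1}.
        ennreal (matrix_norm n (amplification P x)))"

definition completely_contractive ::
  "('h::complex_hilbert_space \<Rightarrow>\<^sub>L 'h) set \<Rightarrow> (('h \<Rightarrow>\<^sub>L 'h) \<Rightarrow> ('h \<Rightarrow>\<^sub>L 'h)) \<Rightarrow> bool" where
  "completely_contractive A P \<longleftrightarrow> map_on A P \<and> cb_norm A P \<le> 1"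

definition completely_bicontractive ::
  "('h::complex_hilbert_space \<Rightarrow>\<^sub>L 'h) set \<Rightarrow> (('h \<Rightarrow>\<^sub>L 'h) \<Rightarrow> ('h \<Rightarrow>\<^sub>L 'h)) \<Rightarrow> bool" where
  "completely_bicontractive A P \<longleftrightarrow>
     projection_on A P \<and> completely_contractive A P \<and>
     completely_contractive A (\<lambda>T. T - P T)"

definition completely_symmetric ::
  "('h::complex_hilbert_space \<Rightarrow>\<^sub>L 'h) set \<Rightarrow> (('h \<Rightarrow>\<^sub>L 'h) \<Rightarrow> ('h \<Rightarrow>\<^sub>L 'h)) \<Rightarrow> bool" where
  "completely_symmetric A P \<longleftrightarrow>
     projection_on A P \<and> cb_norm A (\<lambda>T. T - 2 *\<^sub>R P T) \<le> 1"

definition real_completely_positive ::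
  "('h::complex_hilbert_space \<Rightarrow>\<^sub>L 'h) set \<Rightarrow> (('h \<Rightarrow>\<^sub>L 'h) \<Rightarrow> ('h \<Rightarrow>\<^sub>L 'h)) \<Rightarrow> bool" where
  "real_completely_positive A P \<longleftrightarrow>
     map_on A P \<and> (\<forall>n. \<forall>x\<in>accretive n A. amplification P x \<in> accretive n A)"

end

theory Submission
  imports Defs
begin

text \<open>
  Call an operator accretive if the real part of its quadratic form is nonnegative.  The algebra \<open>D\<close>
  of the theorem is the span of the accretive elements of \<open>A\<close>.  Two facts about accretive
  elements carry the proof.

  First, every approximately unital operator algebra \<open>E\<close> is spanned by its accretive elements
  (\<open>accretive_decomposition\<close>).  Given \<open>a\<close> in \<open>E\<close>, one looks for \<open>b\<close> in \<open>E\<close> such that \<open>b + a\<close> and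
  \<open>b - a\<close> are both accretive.  In the unitization a multiple of the identity would do.  The identity is
  replaced by a sum of scaled approximate units, each of which absorbs half of the remaining
  defect; the approximate units are made almost accretive by a Moebius transformation of the disc
  (\<open>almost_accretive_approximate_unit\<close>, \<open>halve_domination_defect\<close>).

  Secondly, in an arbitrary operator algebra \<open>A\<close> all accretive elements share one contractive
  approximate identity that consists of accretive elements (\<open>accretive_local_unit\<close>).  Its members
  are the Yosida regularizations \<open>s x inverse (1 + s x)\<close> of accretive \<open>x\<close>, which lie in \<open>A\<close>, are contractive
  and, for large \<open>s\<close>, act as a unit on everything dominated by \<open>x\<close>.

  Let \<open>D\<close> be the set of all \<open>a\<close> in \<open>A\<close> on which this approximate identity acts as a unit from both
  sides (\<open>unital_core\<close>).  It is a closed subalgebra, it is hereditary because absorption only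
  concerns the outer factors of a product, and it contains the accretive elements of \<open>A\<close>, hence its own
  approximate identity.  By the first fact, an approximately unital subalgebra of \<open>A\<close> is spanned by
  accretive elements of \<open>A\<close> and so is contained in \<open>D\<close>; and \<open>D\<close> itself is spanned by accretive
  elements, so that a real positive map on \<open>A\<close> sends \<open>D\<close> into \<open>D\<close>.  Complete contractivity and its
  variants pass to the restriction because the matrix norms on \<open>D\<close> are inherited from \<open>A\<close>.
\<close>

section \<open>Adjoints and accretive operators\<close>

text \<open>This makes the bounded operators on a Hilbert space a complete metric space.\<close>

instance complex_hilbert_space \<subseteq> banach ..

text \<open>
  The minimizer of \<open>\<parallel>x\<parallel>\<^sup>2 - 2 f(x)\<close> represents \<open>f\<close>: the parallelogram law makes every minimizing
  sequence Cauchy, and stationarity at the minimum is the representation formula.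
\<close>

theorem Riesz_representation:
  fixes f :: "'a::{real_inner, complete_space} \<Rightarrow> real"
  assumes "bounded_linear f"
  obtains w where "\<And>x. f x = inner x w"
proof -
  interpret f: bounded_linear f by fact
  define J where "J x = inner x x - 2 * f x" for x
  obtain K where K: "\<And>x. norm (f x) \<le> norm x * K"
    using f.bounded by blast
  have J_lower: "- K\<^sup>2 \<le> J x" for x
  proof -
    have "0 \<le> (norm x - K)\<^sup>2" by simp
    also have "\<dots> = inner x x - 2 * (norm x * K) + K\<^sup>2"
      by (simp add: power2_diff power2_norm_eq_inner algebra_simps)
    finally show ?thesis using K[of x] unfolding J_def by simp
  qed
  define m where "m = (INF x. J x)"
  have bdd: "bdd_below (range J)"
    using J_lower by (intro bdd_belowI2)
  have m: "m \<le> J x" for x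
    unfolding m_def using bdd by (simp add: cINF_lower)
  have "\<exists>x. J x < m + 1 / Suc n" for n :: nat
  proof -
    have "Inf (range J) < m + 1 / Suc n" by (simp add: m_def)
    then obtain y where "y \<in> range J" "y < m + 1 / Suc n"
      using cInf_lessD[of "range J"] by blast
    then show ?thesis by blast
  qed
  then obtain X where X: "\<And>n. J (X n) < m + 1 / Suc n" by metis
  have parallelogram: "(norm (x - y))\<^sup>2 = 2 * J x + 2 * J y - 4 * J ((1/2) *\<^sub>R (x + y))" for x y
    unfolding J_def power2_norm_eq_inner
    by (simp add: f.add f.scaleR inner_simps algebra_simps inner_commute)
  have "Cauchy X"
  proof (rule CauchyI')
    fix e :: real
    assume "0 < e"
    then obtain M :: nat where M: "4 / e\<^sup>2 < M" using reals_Archimedean2 by blast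
    have "norm (X i - X j) < e" if "i \<ge> M" "j \<ge> M" for i j
    proof -
      define d where "d = 1 / real (Suc M)"
      have near: "J (X k) \<le> m + d" if "k \<ge> M" for k
      proof -
        have "1 / real (Suc k) \<le> d"
          unfolding d_def using that by (intro divide_left_mono) auto
        then show ?thesis using X[of k] by linarith
      qed
      have "(norm (X i - X j))\<^sup>2 \<le> 4 * d"
        using parallelogram[of "X i" "X j"] m[of "(1/2) *\<^sub>R (X i + X j)"]
          near[OF that(1)] near[OF that(2)]
        by linarith
      also have "\<dots> = 4 / Suc M" by (simp add: d_def)
      also have "\<dots> < e\<^sup>2"
        using M \<open>0 < e\<close> by (simp add: field_simps) (smt (verit) zero_less_power)
      finally show ?thesis using \<open>0 < e\<close> by (simp add: power2_less_imp_less)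
    qed
    then show "\<exists>M. \<forall>i\<ge>M. \<forall>j>i. dist (X i) (X j) < e"
      by (intro exI[of _ M]) (auto simp: dist_norm)
  qed
  then obtain w where w: "X \<longlonglongrightarrow> w"
    using Cauchy_convergent convergent_def by blast
  have "(\<lambda>n. J (X n)) \<longlonglongrightarrow> J w"
    unfolding J_def by (intro tendsto_intros w f.tendsto)
  moreover have "(\<lambda>n. m + 1 / Suc n) \<longlonglongrightarrow> m + 0"
    by (intro tendsto_add tendsto_const LIMSEQ_inverse_real_of_nat[unfolded inverse_eq_divide])
  ultimately have "J w \<le> m"
    using X LIMSEQ_le[of "\<lambda>n. J (X n)" "J w" "\<lambda>n. m + 1 / Suc n" "m + 0"]
    by (auto intro: less_imp_le)
  have "f z = inner z w" for z
  proof -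
    define c where "c = 2 * inner z w - 2 * f z"
    define q where "q = inner z z + 1"
    have "q > 0" by (simp add: q_def add_nonneg_pos)
    have "0 \<le> t * c + t\<^sup>2 * inner z z" for t
      using m[of "w + t *\<^sub>R z"] \<open>J w \<le> m\<close> unfolding J_def c_def
      by (simp add: f.add f.scaleR inner_simps algebra_simps inner_commute power2_eq_square)
    \<comment> \<open>The quadratic polynomial in \<open>t\<close> is nonnegative and vanishes at \<open>t = 0\<close>, so its slope
      \<open>c\<close> there is zero: at \<open>t = - c / q\<close> it takes the value \<open>- c\<^sup>2 / q\<^sup>2\<close>, where \<open>q\<close> is positive
      even for \<open>z = 0\<close>.\<close>
    from this[of "- c / q"] have "0 \<le> (- c / q * c + (- c / q)\<^sup>2 * (q - 1)) * q\<^sup>2"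
      by (simp add: q_def)
    also have "\<dots> = - c\<^sup>2"
      using \<open>q > 0\<close> by (simp add: field_simps power2_eq_square)
    finally have "c = 0" by simp
    then show ?thesis by (simp add: c_def)
  qed
  then show ?thesis using that by blast
qed

lemma inner_adjoint_exists:
  fixes T :: "'a::{real_inner, complete_space} \<Rightarrow>\<^sub>L 'a"
  obtains S :: "'a \<Rightarrow>\<^sub>L 'a" where "\<And>\<xi> \<eta>. inner (T \<xi>) \<eta> = inner \<xi> (S \<eta>)"
proof -
  have "\<exists>w. \<forall>\<xi>. inner (T \<xi>) \<eta> = inner \<xi> w" for \<eta>
  proof -
    have "bounded_linear (\<lambda>\<xi>. inner (T \<xi>) \<eta>)"
      by (intro bounded_linear_inner_left_comp blinfun.bounded_linear_right)
    then show ?thesis using Riesz_representation by metis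
  qed
  then obtain S where S: "\<And>\<xi> \<eta>. inner (T \<xi>) \<eta> = inner \<xi> (S \<eta>)" by metis
  have "bounded_linear S"
  proof (rule bounded_linear_intro)
    show "S (x + y) = S x + S y" for x y
      by (subst vector_eq_ldot[symmetric]) (simp add: S[symmetric] inner_add_right)
    show "S (r *\<^sub>R x) = r *\<^sub>R S x" for r x
      by (subst vector_eq_ldot[symmetric]) (simp add: S[symmetric])
    show "norm (S \<eta>) \<le> norm \<eta> * norm T" for \<eta>
    proof -
      have "norm (S \<eta>) * norm (S \<eta>) = inner (T (S \<eta>)) \<eta>"
        by (metis S power2_eq_square power2_norm_eq_inner)
      also have "\<dots> \<le> norm (T (S \<eta>)) * norm \<eta>" by (rule norm_cauchy_schwarz)
      also have "\<dots> \<le> norm T * norm (S \<eta>) * norm \<eta>"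
        by (intro mult_right_mono norm_blinfun) auto
      finally have *: "norm (S \<eta>) * norm (S \<eta>) \<le> (norm \<eta> * norm T) * norm (S \<eta>)"
        by (simp add: mult_ac)
      show ?thesis
      proof (cases "S \<eta> = 0")
        case False
        with * show ?thesis by (simp add: mult_le_cancel_right)
      qed simp
    qed
  qed
  then show ?thesis using that[of "Blinfun S"] S by (simp add: bounded_linear_Blinfun_apply)
qed

definition accretive_operator :: "('a::real_inner \<Rightarrow>\<^sub>L 'a) \<Rightarrow> bool" where
  "accretive_operator T \<longleftrightarrow> (\<forall>\<xi>. 0 \<le> inner (T \<xi>) \<xi>)"

lemma cinner_eqI:
  fixes x y :: "'h::complex_hilbert_space"
  assumes "\<And>z. cinner z x = cinner z y"
  shows "x = y"
proof -
  have "inner z x = inner z y" for z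
    using arg_cong[OF assms[of z], of Re] by (simp only: Re_cinner)
  then show ?thesis using vector_eq_ldot[of x y] by simp
qed

text \<open>
  The complex inner product is determined by the real one; therefore an adjoint with respect to
  the real inner product of a complex-linear operator is already its Hilbert space adjoint.
\<close>

lemma Im_cinner: "Im (cinner x y) = inner ((- \<i>) *\<^sub>C x) y"
  unfolding Re_cinner[symmetric] by (simp add: cinner_scaleC_left)

lemma cinner_op_adjoint:
  assumes "T \<in> bounded_operators"
  shows "cinner (blinfun_apply T \<xi>) \<eta> = cinner \<xi> (blinfun_apply (op_adjoint T) \<eta>)"
proof -
  obtain S where S: "\<And>\<xi> \<eta>. inner (T \<xi>) \<eta> = inner \<xi> (blinfun_apply S \<eta>)"
    using inner_adjoint_exists by blast
  have adj: "cinner (T \<xi>) \<eta> = cinner \<xi> (S \<eta>)" for \<xi> \<eta>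
  proof -
    have "T ((- \<i>) *\<^sub>C \<xi>) = (- \<i>) *\<^sub>C T \<xi>"
      using assms by (simp add: bounded_operators_def)
    then have "Im (cinner (T \<xi>) \<eta>) = Im (cinner \<xi> (S \<eta>))"
      unfolding Im_cinner by (metis S)
    then show ?thesis
      using S[of \<xi> \<eta>] by (simp only: complex_eq_iff Re_cinner simp_thms)
  qed
  have unique: "S' = S" if "\<forall>\<xi> \<eta>. cinner (T \<xi>) \<eta> = cinner \<xi> (blinfun_apply S' \<eta>)" for S'
  proof (rule blinfun_eqI, rule cinner_eqI)
    show "cinner z (S' \<eta>) = cinner z (S \<eta>)" for z \<eta>
      using that[rule_format, of z \<eta>] adj[of z \<eta>] by (rule trans[OF sym])
  qed
  have "op_adjoint T = S"
    unfolding op_adjoint_def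
  proof (rule the_equality)
    show "\<forall>\<xi> \<eta>. cinner (T \<xi>) \<eta> = cinner \<xi> (S \<eta>)"
      using adj by blast
  qed (rule unique)
  then show ?thesis using adj by (simp only:)
qed

text \<open>
  At size one, membership in \<open>accretive 1 A\<close> becomes a statement about the real quadratic form of a
  single operator.  This is the form in which accretivity is used throughout.
\<close>

lemma accretive_one_iff:
  assumes "A \<subseteq> bounded_operators"
  shows "(\<lambda>i j. T) \<in> accretive 1 A \<longleftrightarrow> T \<in> A \<and> accretive_operator T"
proof (cases "T \<in> A")
  case True
  then have T: "T \<in> bounded_operators" using assms by blast
  have "cinner (T \<xi> + op_adjoint T \<xi>) \<xi> = complex_of_real (2 * inner (T \<xi>) \<xi>)" for \<xi>
  proof -
    have "cinner (op_adjoint T \<xi>) \<xi> = cnj (cinner (T \<xi>) \<xi>)"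
      using cinner_op_adjoint[OF T] by (metis cinner_commute)
    then show ?thesis
      by (simp add: cinner_add_left complex_eq_iff Re_cinner)
  qed
  then have "0 \<le> cinner (T \<xi> + op_adjoint T \<xi>) \<xi> \<longleftrightarrow> 0 \<le> inner (T \<xi>) \<xi>" for \<xi>
    by (simp add: less_eq_complex_def)
  with True show ?thesis
    by (auto simp: accretive_def matrices_def matrix_nonneg_def matrix_apply_def
        matrix_adjoint_def accretive_operator_def blinfun.add_left)
qed (auto simp: accretive_def matrices_def)

lemma real_completely_positive_imp_accretive:
  assumes "real_completely_positive A P" and "A \<subseteq> bounded_operators"
    and "T \<in> A" and "accretive_operator T"
  shows "accretive_operator (P T)"
proof -
  have "(\<lambda>i j. T) \<in> accretive 1 A"
    using accretive_one_iff[OF assms(2)] assms(3,4) by (rule iffD2[OF _ conjI])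
  then have "amplification P (\<lambda>i j. T) \<in> accretive 1 A"
    using assms(1) unfolding real_completely_positive_def by (elim conjE allE ballE) auto
  then have "(\<lambda>i j. P T) \<in> accretive 1 A"
    by (simp add: amplification_def)
  then show ?thesis
    using accretive_one_iff[OF assms(2)] by (rule iffD1[THEN conjunct2, rotated])
qed

section \<open>Operator algebras as closed real algebras\<close>

lemma scaleC_op_of_real: "scaleC_op (complex_of_real r) T = r *\<^sub>R T"
  by (rule blinfun_eqI) (simp add: scaleC_op.rep_eq scaleC_of_real blinfun.scaleR_left)

context
  fixes A :: "('h::complex_hilbert_space \<Rightarrow>\<^sub>L 'h) set"
  assumes A: "operator_algebra A"
begin

lemma operator_algebra_zero: "0 \<in> A"
  and operator_algebra_add: "S \<in> A \<Longrightarrow> T \<in> A \<Longrightarrow> S + T \<in> A"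
  and operator_algebra_compose: "S \<in> A \<Longrightarrow> T \<in> A \<Longrightarrow> S o\<^sub>L T \<in> A"
  and operator_algebra_closed: "closed A"
  using A by (auto simp: operator_algebra_def)

lemma operator_algebra_scaleR: "T \<in> A \<Longrightarrow> r *\<^sub>R T \<in> A"
  using A by (auto simp: operator_algebra_def simp flip: scaleC_op_of_real)

lemma operator_algebra_diff: "S \<in> A \<Longrightarrow> T \<in> A \<Longrightarrow> S - T \<in> A"
  using operator_algebra_add[of S "(-1) *\<^sub>R T"] operator_algebra_scaleR[of T "-1"] by simp

lemma operator_algebra_sum:
  "finite I \<Longrightarrow> (\<And>i. i \<in> I \<Longrightarrow> f i \<in> A) \<Longrightarrow> sum f I \<in> A"
  by (induction I rule: finite_induct) (auto intro: operator_algebra_zero operator_algebra_add)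

text \<open>
  This replaces inversion in the unitization: the fixed point is \<open>inverse (1 - T) C\<close>, and the
  contraction principle on the complete set \<open>A\<close> shows at once that it lies in \<open>A\<close>.
\<close>

lemma affine_fixpoint:
  assumes "T \<in> A" "C \<in> A" "norm T < 1"
  obtains V where "V \<in> A" "V = C + (T o\<^sub>L V)"
proof -
  have "\<exists>!V. V \<in> A \<and> C + (T o\<^sub>L V) = V"
  proof (rule Banach_fix)
    show "complete A" using operator_algebra_closed by (simp add: complete_eq_closed)
    show "A \<noteq> {}" using assms by blast
    show "0 \<le> norm T" "norm T < 1" using assms by auto
    show "(\<lambda>V. C + (T o\<^sub>L V)) ` A \<subseteq> A"
      using assms by (auto intro: operator_algebra_add operator_algebra_compose)
    show "dist (C + (T o\<^sub>L V)) (C + (T o\<^sub>L W)) \<le> norm T * dist V W" if "V \<in> A" "W \<in> A" for V W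
    proof -
      have "(C + (T o\<^sub>L V)) - (C + (T o\<^sub>L W)) = T o\<^sub>L (V - W)"
        by (rule blinfun_eqI) (simp add: blinfun.bilinear_simps)
      then show ?thesis using norm_blinfun_compose[of T "V - W"] by (simp add: dist_norm)
    qed
  qed
  then show ?thesis using that by metis
qed

end

lemma norm_blinfun_le: "norm T \<le> c \<Longrightarrow> norm (blinfun_apply T \<xi>) \<le> c * norm \<xi>"
  by (meson mult_right_mono norm_blinfun norm_ge_zero order_trans)

section \<open>Domination in approximately unital algebras\<close>

text \<open>
  A contraction that fixes \<open>y\<close> has an adjoint that fixes \<open>y\<close>; this is the quantitative form of that
  fact.  It turns one-sided approximate units into units for quadratic forms.
\<close>

lemma contraction_inner_fixed:
  fixes V :: "'a::{real_inner, complete_space} \<Rightarrow>\<^sub>L 'a"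
  assumes V: "norm V \<le> 1" and \<theta>: "norm (y - V y) \<le> \<theta>"
  shows "\<bar>inner y (\<xi> - V \<xi>)\<bar> \<le> sqrt (2 * norm y * \<theta>) * norm \<xi>"
proof -
  obtain S where S: "\<And>\<xi> \<eta>. inner (V \<xi>) \<eta> = inner \<xi> (blinfun_apply S \<eta>)"
    using inner_adjoint_exists by blast
  have "norm (S y) * norm (S y) \<le> norm (S y) * norm y"
  proof -
    have "norm (S y) * norm (S y) = inner (V (S y)) y"
      by (simp add: S flip: power2_eq_square power2_norm_eq_inner)
    also have "\<dots> \<le> norm (V (S y)) * norm y" by (rule norm_cauchy_schwarz)
    also have "\<dots> \<le> norm (S y) * norm y"
      using norm_blinfun_le[OF V, of "S y"] by (simp add: mult_right_mono)
    finally show ?thesis .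
  qed
  then have "norm (S y) \<le> norm y"
    by (cases "S y = 0") auto
  then have "(norm (S y))\<^sup>2 \<le> (norm y)\<^sup>2" by (simp add: power_mono)
  then have "(norm (y - S y))\<^sup>2 \<le> 2 * inner (y - V y) y"
    using S[of y y] by (simp add: power2_norm_eq_inner inner_simps inner_commute)
  also have "\<dots> \<le> 2 * (norm (y - V y) * norm y)" by (simp add: norm_cauchy_schwarz)
  also have "\<dots> \<le> 2 * norm y * \<theta>"
    using mult_left_mono[OF \<theta> norm_ge_zero[of y]] by (simp add: mult_ac)
  finally have "norm (y - S y) \<le> sqrt (2 * norm y * \<theta>)"
    by (rule real_le_rsqrt)
  then have "norm (y - S y) * norm \<xi> \<le> sqrt (2 * norm y * \<theta>) * norm \<xi>"
    by (rule mult_right_mono) simp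
  moreover have "inner y (\<xi> - V \<xi>) = inner (y - S y) \<xi>"
    using S[of \<xi> y] by (simp add: inner_simps inner_commute)
  ultimately show ?thesis
    using Cauchy_Schwarz_ineq2[of "y - S y" \<xi>] by linarith
qed

lemma approximately_unital_obtain:
  assumes "approximately_unital E" "finite X" "X \<subseteq> E" "0 < \<epsilon>"
  obtains T where "T \<in> E" "norm T \<le> 1"
    "\<And>h. h \<in> X \<Longrightarrow> norm ((T o\<^sub>L h) - h) < \<epsilon>" "\<And>h. h \<in> X \<Longrightarrow> norm ((h o\<^sub>L T) - h) < \<epsilon>"
proof -
  obtain F where F: "F \<noteq> bot" "\<forall>\<^sub>F e in F. e \<in> E \<and> norm e \<le> 1"
    "\<And>a. a \<in> E \<Longrightarrow> ((\<lambda>e. e o\<^sub>L a) \<longlongrightarrow> a) F" "\<And>a. a \<in> E \<Longrightarrow> ((\<lambda>e. a o\<^sub>L e) \<longlongrightarrow> a) F"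
    using assms(1) unfolding approximately_unital_def by blast
  have "\<forall>\<^sub>F e in F. \<forall>h\<in>X. norm ((e o\<^sub>L h) - h) < \<epsilon> \<and> norm ((h o\<^sub>L e) - h) < \<epsilon>"
  proof (intro eventually_ball_finite \<open>finite X\<close> ballI)
    fix h assume "h \<in> X"
    then have "h \<in> E" using \<open>X \<subseteq> E\<close> by blast
    show "\<forall>\<^sub>F e in F. norm ((e o\<^sub>L h) - h) < \<epsilon> \<and> norm ((h o\<^sub>L e) - h) < \<epsilon>"
      using tendstoD[OF F(3)[OF \<open>h \<in> E\<close>] \<open>0 < \<epsilon>\<close>] tendstoD[OF F(4)[OF \<open>h \<in> E\<close>] \<open>0 < \<epsilon>\<close>]
      unfolding dist_norm by (rule eventually_conj)
  qed
  with F(2) have "\<forall>\<^sub>F e in F. (e \<in> E \<and> norm e \<le> 1) \<and>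
      (\<forall>h\<in>X. norm ((e o\<^sub>L h) - h) < \<epsilon> \<and> norm ((h o\<^sub>L e) - h) < \<epsilon>)"
    by (rule eventually_conj)
  then show ?thesis
    using F(1) that eventually_happens[of _ F] by blast
qed

lemma norm_triangle3: "norm (x + y + z) \<le> norm x + norm y + norm (z :: 'a::real_normed_vector)"
  by (intro norm_triangle_mono norm_triangle_ineq order_refl)

text \<open>
  A contractive approximate unit \<open>T\<close> need not be close to accretive.  A Moebius transformation that
  fixes 0 and 1 repairs this: \<open>z \<mapsto> (1 - r) z / (1 - r z)\<close> maps the unit disc into a disc that
  for \<open>r\<close> near 1 is only slightly larger than the one with diameter \<open>[0, 1]\<close>, and since it
  fixes 1 its value at \<open>T\<close> is still an approximate unit.  The parameter \<open>r = 2/3\<close> gives the defect 1/4, which is small enough for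
  the iteration below.
\<close>

lemma almost_accretive_approximate_unit:
  fixes E :: "('h::complex_hilbert_space \<Rightarrow>\<^sub>L 'h) set"
  assumes E: "operator_algebra E" "approximately_unital E"
    and X: "finite X" "X \<subseteq> E" and "0 < \<epsilon>"
  obtains V where "V \<in> E" "norm V \<le> 1"
    "\<And>\<xi>. (norm (V \<xi>))\<^sup>2 \<le> inner (V \<xi>) \<xi> + (norm \<xi>)\<^sup>2 / 4"
    "\<And>h. h \<in> X \<Longrightarrow> norm ((V o\<^sub>L h) - h) \<le> \<epsilon>" "\<And>h. h \<in> X \<Longrightarrow> norm ((h o\<^sub>L V) - h) \<le> \<epsilon>"
proof -
  obtain T where T: "T \<in> E" "norm T \<le> 1"
    "\<And>h. h \<in> X \<Longrightarrow> norm ((T o\<^sub>L h) - h) < \<epsilon> / 3" "\<And>h. h \<in> X \<Longrightarrow> norm ((h o\<^sub>L T) - h) < \<epsilon> / 3"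
    using approximately_unital_obtain[OF E(2) X, of "\<epsilon> / 3"] \<open>0 < \<epsilon>\<close> by auto
  \<comment> \<open>The defining equation of \<open>V = (1/3) T inverse (1 - (2/3) T)\<close>.\<close>
  obtain V where V: "V \<in> E" "V = (1/3) *\<^sub>R T + (((2/3) *\<^sub>R T) o\<^sub>L V)"
    by (rule affine_fixpoint[OF E(1), of "(2/3) *\<^sub>R T" "(1/3) *\<^sub>R T"])
      (use T in \<open>auto intro: operator_algebra_scaleR[OF E(1)]\<close>)
  have V_apply: "3 *\<^sub>R V \<xi> = T (\<xi> + 2 *\<^sub>R V \<xi>)" for \<xi>
  proof -
    have "3 *\<^sub>R V \<xi> = 3 *\<^sub>R ((1/3) *\<^sub>R T + (((2/3) *\<^sub>R T) o\<^sub>L V)) \<xi>"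
      using V(2) by (rule arg_cong)
    also have "\<dots> = T (\<xi> + 2 *\<^sub>R V \<xi>)"
      by (simp add: blinfun.bilinear_simps scaleR_add_right)
    finally show ?thesis .
  qed
  \<comment> \<open>With \<open>\<zeta> = \<xi> + 2 V \<xi>\<close> one has \<open>3 V \<xi> = T \<zeta>\<close>, so all information about \<open>V\<close> comes from
    \<open>\<parallel>T \<zeta>\<parallel> \<le> \<parallel>\<zeta>\<parallel>\<close>.\<close>
  have key: "(norm (3 *\<^sub>R V \<xi>))\<^sup>2 \<le> (norm (\<xi> + 2 *\<^sub>R V \<xi>))\<^sup>2" for \<xi>
    unfolding V_apply using norm_blinfun_le[OF T(2)] by (simp add: power_mono)
  have quad: "5 * (norm (V \<xi>))\<^sup>2 \<le> (norm \<xi>)\<^sup>2 + 4 * inner (V \<xi>) \<xi>" for \<xi>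
    using key[of \<xi>] by (simp add: power2_norm_eq_inner inner_simps inner_commute)
  have V_norm: "norm V \<le> 1"
  proof (rule norm_blinfun_bound)
    show "norm (V \<xi>) \<le> 1 * norm \<xi>" for \<xi>
    proof -
      have "3 * norm (V \<xi>) \<le> norm (\<xi> + 2 *\<^sub>R V \<xi>)"
        using norm_blinfun_le[OF T(2), of "\<xi> + 2 *\<^sub>R V \<xi>"] V_apply[of \<xi>]
        by (metis abs_numeral mult_1 norm_scaleR)
      also have "\<dots> \<le> norm \<xi> + 2 * norm (V \<xi>)"
        using norm_triangle_ineq[of \<xi> "2 *\<^sub>R V \<xi>"] by simp
      finally show ?thesis by simp
    qed
  qed simp
  show ?thesis
  proof
    show "V \<in> E" by fact
    show "norm V \<le> 1" by fact
    show "(norm (V \<xi>))\<^sup>2 \<le> inner (V \<xi>) \<xi> + (norm \<xi>)\<^sup>2 / 4" for \<xi>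
      using quad[of \<xi>] zero_le_power2[of "norm (V \<xi>)"] by linarith
  next
    fix h assume "h \<in> X"
    have left: "3 *\<^sub>R ((V o\<^sub>L h) - h) = ((T o\<^sub>L h) - h) + 2 *\<^sub>R (T o\<^sub>L ((V o\<^sub>L h) - h)) + 2 *\<^sub>R ((T o\<^sub>L h) - h)"
    proof (rule blinfun_eqI)
      fix \<xi>
      show "(3 *\<^sub>R ((V o\<^sub>L h) - h)) \<xi> =
        (((T o\<^sub>L h) - h) + 2 *\<^sub>R (T o\<^sub>L ((V o\<^sub>L h) - h)) + 2 *\<^sub>R ((T o\<^sub>L h) - h)) \<xi>"
        using V_apply[of "h \<xi>"] scaleR_add_left[of 1 2 "h \<xi>"] by (simp add: blinfun.bilinear_simps algebra_simps)
    qed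
    have "norm (3 *\<^sub>R ((V o\<^sub>L h) - h)) \<le> norm ((T o\<^sub>L h) - h)
        + norm (2 *\<^sub>R (T o\<^sub>L ((V o\<^sub>L h) - h))) + norm (2 *\<^sub>R ((T o\<^sub>L h) - h))"
      unfolding left by (rule norm_triangle3)
    moreover have "norm (T o\<^sub>L ((V o\<^sub>L h) - h)) \<le> 1 * norm ((V o\<^sub>L h) - h)"
      using norm_blinfun_compose mult_right_mono[OF T(2) norm_ge_zero] by (rule order_trans)
    ultimately show "norm ((V o\<^sub>L h) - h) \<le> \<epsilon>"
      using T(3)[OF \<open>h \<in> X\<close>] by simp
    have right: "3 *\<^sub>R ((h o\<^sub>L V) - h) = ((h o\<^sub>L T) - h) + 2 *\<^sub>R (((h o\<^sub>L T) - h) o\<^sub>L V) + 2 *\<^sub>R ((h o\<^sub>L V) - h)"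
    proof (rule blinfun_eqI)
      fix \<xi>
      show "(3 *\<^sub>R ((h o\<^sub>L V) - h)) \<xi> =
        (((h o\<^sub>L T) - h) + 2 *\<^sub>R (((h o\<^sub>L T) - h) o\<^sub>L V) + 2 *\<^sub>R ((h o\<^sub>L V) - h)) \<xi>"
        using arg_cong[OF V_apply[of \<xi>], of h] scaleR_add_left[of 1 2 "h \<xi>"]
        by (simp add: blinfun.bilinear_simps algebra_simps)
    qed
    have "norm (3 *\<^sub>R ((h o\<^sub>L V) - h)) \<le> norm ((h o\<^sub>L T) - h)
        + norm (2 *\<^sub>R (((h o\<^sub>L T) - h) o\<^sub>L V)) + norm (2 *\<^sub>R ((h o\<^sub>L V) - h))"
      unfolding right by (rule norm_triangle3)
    moreover have "norm (((h o\<^sub>L T) - h) o\<^sub>L V) \<le> norm ((h o\<^sub>L T) - h) * 1"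
      using norm_blinfun_compose mult_left_mono[OF V_norm norm_ge_zero] by (rule order_trans)
    ultimately show "norm ((h o\<^sub>L V) - h) \<le> \<epsilon>"
      using T(4)[OF \<open>h \<in> X\<close>] by simp
  qed
qed

text \<open>
  If \<open>V\<close> is nearly a unit for \<open>h\<close>, then \<open>h\<close> is nearly equal to its compression \<open>V* h V\<close> as a quadratic
  form, so lower bounds for \<open>h\<close> may be tested on vectors in the range of \<open>V\<close>.
\<close>

lemma compress_inner_estimate:
  fixes V :: "'a::{real_inner, complete_space} \<Rightarrow>\<^sub>L 'a"
  assumes V: "norm V \<le> 1" and "norm ((V o\<^sub>L h) - h) \<le> \<theta>" "norm ((h o\<^sub>L V) - h) \<le> \<theta>"
  shows "\<bar>inner (h \<xi>) \<xi> - inner (h (V \<xi>)) (V \<xi>)\<bar> \<le> (sqrt (2 * norm h * \<theta>) + \<theta>) * (norm \<xi>)\<^sup>2"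
proof -
  have "0 \<le> \<theta>" using assms(2) norm_ge_zero order_trans by blast
  have "norm (h \<xi> - V (h \<xi>)) \<le> \<theta> * norm \<xi>"
    using norm_blinfun_le[OF assms(2), of \<xi>]
    by (simp add: blinfun.diff_left norm_minus_commute[of "h \<xi>" "V (h \<xi>)"])
  then have "\<bar>inner (h \<xi>) (\<xi> - V \<xi>)\<bar> \<le> sqrt (2 * norm (h \<xi>) * (\<theta> * norm \<xi>)) * norm \<xi>"
    by (rule contraction_inner_fixed[OF V])
  also have "\<dots> \<le> sqrt (2 * (norm h * norm \<xi>) * (\<theta> * norm \<xi>)) * norm \<xi>"
    using \<open>0 \<le> \<theta>\<close>
    by (intro mult_right_mono real_sqrt_le_mono mult_left_mono norm_blinfun) auto
  also have "2 * (norm h * norm \<xi>) * (\<theta> * norm \<xi>) = (2 * norm h * \<theta>) * (norm \<xi>)\<^sup>2"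
    by (simp add: power2_eq_square)
  also have "sqrt \<dots> * norm \<xi> = sqrt (2 * norm h * \<theta>) * (norm \<xi>)\<^sup>2"
    by (simp add: real_sqrt_mult power2_eq_square)
  finally have 1: "\<bar>inner (h \<xi>) (\<xi> - V \<xi>)\<bar> \<le> sqrt (2 * norm h * \<theta>) * (norm \<xi>)\<^sup>2" .
  have "\<bar>inner (h \<xi> - h (V \<xi>)) (V \<xi>)\<bar> \<le> norm (h \<xi> - h (V \<xi>)) * norm (V \<xi>)"
    by (rule Cauchy_Schwarz_ineq2)
  also have "\<dots> \<le> (\<theta> * norm \<xi>) * norm \<xi>"
    using norm_blinfun_le[OF assms(3), of \<xi>] norm_blinfun_le[OF V, of \<xi>] \<open>0 \<le> \<theta>\<close>
    by (intro mult_mono) (auto simp: blinfun.diff_left norm_minus_commute)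
  finally have 2: "\<bar>inner (h \<xi> - h (V \<xi>)) (V \<xi>)\<bar> \<le> \<theta> * (norm \<xi>)\<^sup>2"
    by (simp add: power2_eq_square)
  have "inner (h \<xi>) \<xi> - inner (h (V \<xi>)) (V \<xi>)
      = inner (h \<xi>) (\<xi> - V \<xi>) + inner (h \<xi> - h (V \<xi>)) (V \<xi>)"
    by (simp add: inner_simps)
  with 1 2 show ?thesis unfolding distrib_right by linarith
qed

text \<open>
  The operator \<open>b\<close> dominates \<open>a\<close> up to a multiple \<open>\<eta>\<close> of the identity, which need not belong to
  \<open>E\<close>.  Adding \<open>\<eta> V\<close> for an almost accretive approximate unit \<open>V\<close> halves the defect: compressing by
  \<open>V\<close> shrinks it from \<open>\<eta> \<parallel>\<xi>\<parallel>\<^sup>2\<close> to \<open>\<eta> \<parallel>V \<xi>\<parallel>\<^sup>2\<close>, and this is at most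
  \<open>\<eta> Re \<langle>V \<xi>, \<xi>\<rangle>\<close> up to a quarter of the old defect.
\<close>

lemma halve_domination_defect:
  fixes E :: "('h::complex_hilbert_space \<Rightarrow>\<^sub>L 'h) set"
  assumes E: "operator_algebra E" "approximately_unital E"
    and "a \<in> E" "b \<in> E" "0 < \<eta>"
    and dom: "\<And>\<xi>. \<bar>inner (a \<xi>) \<xi>\<bar> \<le> inner (b \<xi>) \<xi> + \<eta> * (norm \<xi>)\<^sup>2"
  obtains b' where "b' \<in> E" "norm (b' - b) \<le> \<eta>"
    "\<And>\<xi>. \<bar>inner (a \<xi>) \<xi>\<bar> \<le> inner (b' \<xi>) \<xi> + \<eta> / 2 * (norm \<xi>)\<^sup>2"
proof -
  define M where "M = norm a + norm b + 1"
  have "M > 0" by (simp add: M_def add_nonneg_pos)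
  \<comment> \<open>Both compressions below may cost \<open>\<eta> / 8\<close>, which together with the defect \<open>\<eta> / 4\<close> of \<open>V\<close>
    leaves \<open>\<eta> / 2\<close>; \<open>\<theta>\<close> is chosen so that each summand of the compression error is at most \<open>c\<close>.\<close>
  define c where "c = \<eta> / 16"
  define \<theta> where "\<theta> = min c (c\<^sup>2 / (2 * M))"
  have "c > 0" "\<theta> > 0" using \<open>0 < \<eta>\<close> \<open>M > 0\<close> by (auto simp: c_def \<theta>_def)
  obtain V where V: "V \<in> E" "norm V \<le> 1"
    "\<And>\<xi>. (norm (V \<xi>))\<^sup>2 \<le> inner (V \<xi>) \<xi> + (norm \<xi>)\<^sup>2 / 4"
    "\<And>h. h \<in> {a, b} \<Longrightarrow> norm ((V o\<^sub>L h) - h) \<le> \<theta>" "\<And>h. h \<in> {a, b} \<Longrightarrow> norm ((h o\<^sub>L V) - h) \<le> \<theta>"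
    using almost_accretive_approximate_unit[OF E, of "{a, b}" \<theta>] assms(3,4) \<open>\<theta> > 0\<close> by auto
  have compress: "\<bar>inner (h \<xi>) \<xi> - inner (h (V \<xi>)) (V \<xi>)\<bar> \<le> \<eta> / 8 * (norm \<xi>)\<^sup>2"
    if "h \<in> {a, b}" for h \<xi>
  proof -
    have "2 * norm h * \<theta> \<le> 2 * M * (c\<^sup>2 / (2 * M))"
      using that \<open>\<theta> > 0\<close> \<open>M > 0\<close> by (intro mult_mono) (auto simp: M_def \<theta>_def)
    also have "\<dots> = c\<^sup>2" using \<open>M > 0\<close> by simp
    finally have "sqrt (2 * norm h * \<theta>) \<le> c"
      using \<open>c > 0\<close> by (simp add: real_le_lsqrt)
    moreover have "\<theta> \<le> c" by (simp add: \<theta>_def)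
    ultimately have "sqrt (2 * norm h * \<theta>) + \<theta> \<le> \<eta> / 8" by (simp add: c_def)
    then have "(sqrt (2 * norm h * \<theta>) + \<theta>) * (norm \<xi>)\<^sup>2 \<le> \<eta> / 8 * (norm \<xi>)\<^sup>2"
      by (rule mult_right_mono) simp
    then show ?thesis
      using compress_inner_estimate[OF V(2) V(4,5), OF that that, of \<xi>] by linarith
  qed
  show ?thesis
  proof
    show "b + \<eta> *\<^sub>R V \<in> E"
      using \<open>b \<in> E\<close> V(1) E(1) by (intro operator_algebra_add operator_algebra_scaleR)
    show "norm (b + \<eta> *\<^sub>R V - b) \<le> \<eta>"
      using V(2) \<open>0 < \<eta>\<close> by simp
    show "\<bar>inner (a \<xi>) \<xi>\<bar> \<le> inner ((b + \<eta> *\<^sub>R V) \<xi>) \<xi> + \<eta> / 2 * (norm \<xi>)\<^sup>2" for \<xi>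
    proof -
      define N where "N = \<eta> * (norm \<xi>)\<^sup>2"
      have "\<eta> * (norm (V \<xi>))\<^sup>2 \<le> \<eta> * (inner (V \<xi>) \<xi> + (norm \<xi>)\<^sup>2 / 4)"
        using V(3)[of \<xi>] \<open>0 < \<eta>\<close> by (intro mult_left_mono) auto
      also have "\<dots> = \<eta> * inner (V \<xi>) \<xi> + N / 4"
        by (simp add: N_def algebra_simps)
      finally have "\<eta> * (norm (V \<xi>))\<^sup>2 \<le> \<eta> * inner (V \<xi>) \<xi> + N / 4" .
      moreover have "\<bar>inner (h \<xi>) \<xi> - inner (h (V \<xi>)) (V \<xi>)\<bar> \<le> N / 8" if "h \<in> {a, b}" for h
        using compress[OF that, of \<xi>] by (simp add: N_def)
      from this[of a] this[of b]
      have "\<bar>inner (a \<xi>) \<xi> - inner (a (V \<xi>)) (V \<xi>)\<bar> \<le> N / 8"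
        "\<bar>inner (b \<xi>) \<xi> - inner (b (V \<xi>)) (V \<xi>)\<bar> \<le> N / 8" by auto
      moreover note dom[of "V \<xi>"]
      moreover have "inner ((b + \<eta> *\<^sub>R V) \<xi>) \<xi> = inner (b \<xi>) \<xi> + \<eta> * inner (V \<xi>) \<xi>"
        by (simp add: blinfun.bilinear_simps inner_simps)
      moreover have "\<eta> / 2 * (norm \<xi>)\<^sup>2 = N / 2" by (simp add: N_def)
      ultimately show ?thesis by linarith
    qed
  qed
qed

text \<open>
  Halving the defect repeatedly changes \<open>b\<close> by a summable amount, and in the limit no defect is left.
\<close>

lemma domination_exists:
  fixes E :: "('h::complex_hilbert_space \<Rightarrow>\<^sub>L 'h) set"
  assumes E: "operator_algebra E" "approximately_unital E" and "a \<in> E"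
  obtains b where "b \<in> E" "\<And>\<xi>. \<bar>inner (a \<xi>) \<xi>\<bar> \<le> inner (b \<xi>) \<xi>"
proof -
  define \<eta> where "\<eta> n = (norm a + 1) * (1/2) ^ n" for n :: nat
  have \<eta>_pos: "\<eta> n > 0" for n
    by (simp add: \<eta>_def add_nonneg_pos)
  define dom where "dom n b \<longleftrightarrow> b \<in> E \<and>
    (\<forall>\<xi>. \<bar>inner (a \<xi>) \<xi>\<bar> \<le> inner (blinfun_apply b \<xi>) \<xi> + \<eta> n * (norm \<xi>)\<^sup>2)" for n b
  have "\<exists>b. \<forall>n. dom n (b n) \<and> norm (b (Suc n) - b n) \<le> \<eta> n"
  proof (rule dependent_nat_choice)
    have "\<bar>inner (a \<xi>) \<xi>\<bar> \<le> (norm a + 1) * (norm \<xi>)\<^sup>2" for \<xi>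
    proof -
      have "\<bar>inner (a \<xi>) \<xi>\<bar> \<le> norm (a \<xi>) * norm \<xi>" by (rule Cauchy_Schwarz_ineq2)
      also have "\<dots> \<le> ((norm a + 1) * norm \<xi>) * norm \<xi>"
        by (intro mult_right_mono norm_blinfun_le) auto
      finally show ?thesis by (simp add: power2_eq_square mult.assoc)
    qed
    then show "\<exists>b. dom 0 b"
      using operator_algebra_zero[OF E(1)] by (auto simp: dom_def \<eta>_def intro!: exI[of _ 0])
    show "\<exists>b'. dom (Suc n) b' \<and> norm (b' - b) \<le> \<eta> n" if "dom n b" for b n
    proof -
      obtain b' where "b' \<in> E" "norm (b' - b) \<le> \<eta> n"
        "\<And>\<xi>. \<bar>inner (a \<xi>) \<xi>\<bar> \<le> inner (blinfun_apply b' \<xi>) \<xi> + \<eta> n / 2 * (norm \<xi>)\<^sup>2"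
        using halve_domination_defect[OF E \<open>a \<in> E\<close> _ \<eta>_pos, of b n] \<open>dom n b\<close>
        by (auto simp: dom_def)
      moreover have half: "\<eta> (Suc n) = \<eta> n / 2" by (simp add: \<eta>_def)
      ultimately show ?thesis unfolding dom_def half by blast
    qed
  qed
  then obtain b where "\<forall>n. dom n (b n) \<and> norm (b (Suc n) - b n) \<le> \<eta> n"
    by (rule exE)
  then have b: "\<And>n. dom n (b n)" "\<And>n. norm (b (Suc n) - b n) \<le> \<eta> n"
    by simp_all
  have "summable \<eta>"
    unfolding \<eta>_def by (intro summable_mult summable_geometric) simp
  then have "summable (\<lambda>n. b (Suc n) - b n)"
    by (rule summable_comparison_test'[where N = 0]) (rule b(2))
  then have "(\<lambda>n. b n - b 0) \<longlonglongrightarrow> (\<Sum>n. b (Suc n) - b n)"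
    by (subst sum_lessThan_telescope[symmetric]) (rule summable_LIMSEQ)
  then have lim: "b \<longlonglongrightarrow> (\<Sum>n. b (Suc n) - b n) + b 0" (is "_ \<longlonglongrightarrow> ?b")
    using tendsto_add[OF _ tendsto_const, of "\<lambda>n. b n - b 0" _ sequentially "b 0"] by simp
  have "\<eta> \<longlonglongrightarrow> 0"
    using \<open>summable \<eta>\<close> by (rule summable_LIMSEQ_zero)
  show ?thesis
  proof
    show "?b \<in> E"
      using closed_sequentially[OF operator_algebra_closed[OF E(1)] _ lim] b(1)
      by (simp add: dom_def)
    show "\<bar>inner (a \<xi>) \<xi>\<bar> \<le> inner (?b \<xi>) \<xi>" for \<xi>
    proof (rule LIMSEQ_le_const)
      have "(\<lambda>n. inner (b n \<xi>) \<xi> + \<eta> n * (norm \<xi>)\<^sup>2) \<longlonglongrightarrow> inner (?b \<xi>) \<xi> + 0 * (norm \<xi>)\<^sup>2"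
        by (intro tendsto_intros blinfun.tendsto lim \<open>\<eta> \<longlonglongrightarrow> 0\<close>)
      then show "(\<lambda>n. inner (b n \<xi>) \<xi> + \<eta> n * (norm \<xi>)\<^sup>2) \<longlonglongrightarrow> inner (?b \<xi>) \<xi>"
        by simp
      show "\<exists>N. \<forall>n\<ge>N. \<bar>inner (a \<xi>) \<xi>\<bar> \<le> inner (b n \<xi>) \<xi> + \<eta> n * (norm \<xi>)\<^sup>2"
        using b(1) by (simp add: dom_def)
    qed
  qed
qed

text \<open>
  This makes approximately unital subalgebras visible to maps that only respect accretivity: such
  a subalgebra is spanned by its accretive elements.
\<close>

lemma accretive_decomposition:
  fixes E :: "('h::complex_hilbert_space \<Rightarrow>\<^sub>L 'h) set"
  assumes "operator_algebra E" "approximately_unital E" "a \<in> E"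
  obtains x y where "x \<in> E" "y \<in> E" "accretive_operator x" "accretive_operator y" "a = x - y"
proof -
  obtain b where b: "b \<in> E" "\<And>\<xi>. \<bar>inner (a \<xi>) \<xi>\<bar> \<le> inner (b \<xi>) \<xi>"
    using domination_exists[OF assms] by blast
  show ?thesis
  proof
    show "(1/2) *\<^sub>R (b + a) \<in> E" "(1/2) *\<^sub>R (b - a) \<in> E"
      using assms b(1)
      by (auto intro!: operator_algebra_scaleR operator_algebra_add operator_algebra_diff)
    have "0 \<le> inner ((b + a) \<xi>) \<xi>" "0 \<le> inner ((b - a) \<xi>) \<xi>" for \<xi>
      using b(2)[of \<xi>] by (simp_all add: blinfun.bilinear_simps inner_simps abs_le_iff)
    then show "accretive_operator ((1/2) *\<^sub>R (b + a))" "accretive_operator ((1/2) *\<^sub>R (b - a))"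
      by (simp_all add: accretive_operator_def blinfun.scaleR_left)
    have "(b + a) - (b - a) = 2 *\<^sub>R a" by (simp add: scaleR_2)
    then show "a = (1/2) *\<^sub>R (b + a) - (1/2) *\<^sub>R (b - a)"
      by (simp flip: scaleR_diff_right)
  qed
qed

section \<open>Yosida regularizations of accretive operators\<close>

text \<open>
  For linear maps this is the notion from monotone operator theory.  Equivalently
  \<open>\<parallel>1 - 2 T\<parallel> \<le> 1\<close>, so the class is stable under adjoints.
\<close>

definition firmly_nonexpansive :: "('a::real_inner \<Rightarrow>\<^sub>L 'a) \<Rightarrow> bool" where
  "firmly_nonexpansive T \<longleftrightarrow> (\<forall>\<xi>. (norm (T \<xi>))\<^sup>2 \<le> inner (T \<xi>) \<xi>)"

lemma firmly_nonexpansive_accretive: "firmly_nonexpansive T \<Longrightarrow> accretive_operator T"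
  unfolding firmly_nonexpansive_def accretive_operator_def
  by (meson order_trans zero_le_power2)

lemma firmly_nonexpansive_norm:
  assumes "firmly_nonexpansive T"
  shows "norm T \<le> 1"
proof (rule norm_blinfun_bound)
  show "norm (T \<xi>) \<le> 1 * norm \<xi>" for \<xi>
  proof -
    have "norm (T \<xi>) * norm (T \<xi>) \<le> norm (T \<xi>) * norm \<xi>"
      using assms norm_cauchy_schwarz[of "T \<xi>" \<xi>]
      unfolding firmly_nonexpansive_def power2_eq_square by (rule_tac order_trans) auto
    then show ?thesis by (cases "T \<xi> = 0") auto
  qed
qed simp

lemma firmly_nonexpansive_adjoint:
  assumes T: "firmly_nonexpansive T" and S: "\<And>\<xi> \<eta>. inner (T \<xi>) \<eta> = inner \<xi> (blinfun_apply S \<eta>)"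
  shows "firmly_nonexpansive S"
  unfolding firmly_nonexpansive_def
proof
  fix \<zeta>
  define w where "w = \<zeta> - 2 *\<^sub>R S \<zeta>"
  \<comment> \<open>The reflection \<open>1 - 2 T\<close> is a contraction; its adjoint \<open>1 - 2 S\<close> maps \<open>\<zeta>\<close> to \<open>w\<close>.\<close>
  have "(norm (w - 2 *\<^sub>R T w))\<^sup>2 \<le> (norm w)\<^sup>2"
    using T[unfolded firmly_nonexpansive_def, rule_format, of w]
    by (simp add: power2_norm_eq_inner inner_simps inner_commute)
  then have reflect: "norm (w - 2 *\<^sub>R T w) \<le> norm w"
    by (rule power2_le_imp_le) simp
  have "norm w * norm w = inner (w - 2 *\<^sub>R T w) \<zeta>"
  proof -
    have "norm w * norm w = inner w (\<zeta> - 2 *\<^sub>R S \<zeta>)"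
      by (simp add: w_def flip: power2_eq_square power2_norm_eq_inner)
    then show ?thesis using S[of w \<zeta>] by (simp add: inner_simps)
  qed
  also have "\<dots> \<le> norm (w - 2 *\<^sub>R T w) * norm \<zeta>" by (rule norm_cauchy_schwarz)
  also have "\<dots> \<le> norm w * norm \<zeta>" using reflect by (rule mult_right_mono) simp
  finally have "norm w \<le> norm \<zeta>" by (cases "w = 0") auto
  then have "(norm w)\<^sup>2 \<le> (norm \<zeta>)\<^sup>2" by (simp add: power_mono)
  then show "(norm (S \<zeta>))\<^sup>2 \<le> inner (S \<zeta>) \<zeta>"
    unfolding w_def by (simp add: power2_norm_eq_inner inner_simps inner_commute)
qed

text \<open>
  For accretive \<open>x\<close> and \<open>s \<ge> 0\<close> the equation says \<open>u = s x inverse (1 + s x)\<close>.  Stating it without an inverse keeps all operators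
  inside the algebra.
\<close>

definition yosida :: "real \<Rightarrow> ('a::real_normed_vector \<Rightarrow>\<^sub>L 'a) \<Rightarrow> ('a \<Rightarrow>\<^sub>L 'a) \<Rightarrow> bool" where
  "yosida s x u \<longleftrightarrow> u + s *\<^sub>R (x o\<^sub>L u) = s *\<^sub>R x"

lemma yosida_apply:
  assumes "yosida s x u"
  shows "u \<xi> = s *\<^sub>R x (\<xi> - u \<xi>)"
proof -
  have "(u + s *\<^sub>R (x o\<^sub>L u)) \<xi> = (s *\<^sub>R x) \<xi>"
    using assms by (simp add: yosida_def)
  then show ?thesis
    by (simp add: blinfun.bilinear_simps scaleR_diff_right eq_diff_eq)
qed

lemma yosida_firmly_nonexpansive:
  assumes "accretive_operator x" "yosida s x u" "0 \<le> s"
  shows "firmly_nonexpansive u"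
  unfolding firmly_nonexpansive_def
proof
  fix \<xi>
  have "inner (u \<xi>) (\<xi> - u \<xi>) = s * inner (x (\<xi> - u \<xi>)) (\<xi> - u \<xi>)"
    by (subst (1) yosida_apply[OF assms(2)]) simp
  also have "\<dots> \<ge> 0" using assms(1,3) by (simp add: accretive_operator_def)
  finally show "(norm (u \<xi>))\<^sup>2 \<le> inner (u \<xi>) \<xi>"
    by (simp add: power2_norm_eq_inner inner_simps)
qed

lemma accretive_shift_injective:
  assumes "accretive_operator x" "0 \<le> s" "z + s *\<^sub>R x z = 0"
  shows "z = 0"
proof -
  have "inner z z + s * inner (x z) z = 0"
    using arg_cong[OF assms(3), of "\<lambda>v. inner v z"] by (simp add: inner_simps)
  moreover have "0 \<le> s * inner (x z) z"
    using assms(1,2) by (simp add: accretive_operator_def)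
  ultimately show "z = 0"
    by (smt (verit) inner_eq_zero_iff inner_ge_zero)
qed

lemma yosida_commute:
  assumes "accretive_operator x" "yosida s x u" "0 \<le> s"
  shows "u o\<^sub>L x = x o\<^sub>L u"
proof (rule blinfun_eqI)
  fix \<xi>
  have 1: "u (x \<xi>) + s *\<^sub>R x (u (x \<xi>)) = s *\<^sub>R x (x \<xi>)"
    using arg_cong[OF assms(2)[unfolded yosida_def], of "\<lambda>T. T (x \<xi>)"]
    by (simp add: blinfun.bilinear_simps)
  have "u \<xi> + s *\<^sub>R x (u \<xi>) = s *\<^sub>R x \<xi>"
    using arg_cong[OF assms(2)[unfolded yosida_def], of "\<lambda>T. T \<xi>"]
    by (simp add: blinfun.bilinear_simps)
  from arg_cong[OF this, of x] have 2: "x (u \<xi>) + s *\<^sub>R x (x (u \<xi>)) = s *\<^sub>R x (x \<xi>)"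
    by (simp add: blinfun.bilinear_simps)
  have "(u (x \<xi>) - x (u \<xi>)) + s *\<^sub>R x (u (x \<xi>) - x (u \<xi>))
      = (u (x \<xi>) + s *\<^sub>R x (u (x \<xi>))) - (x (u \<xi>) + s *\<^sub>R x (x (u \<xi>)))"
    by (simp add: blinfun.bilinear_simps scaleR_diff_right)
  also have "\<dots> = 0" unfolding 1 2 by simp
  finally have "u (x \<xi>) - x (u \<xi>) = 0"
    by (rule accretive_shift_injective[OF assms(1,3)])
  then show "(u o\<^sub>L x) \<xi> = (x o\<^sub>L u) \<xi>" by simp
qed

text \<open>
  The fixed point argument yields \<open>u\<close> directly only for small \<open>s\<close>.  Since \<open>u\<close> is a contraction for every
  \<open>s\<close>, the parameter can always be enlarged by a fixed factor: \<open>v = (3/2) u inverse (1 + u/2)\<close>.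
  Any factor below 2 would do.
\<close>

lemma yosida_step:
  assumes A: "operator_algebra A" and x: "accretive_operator x"
    and u: "u \<in> A" "yosida s x u" "0 \<le> s"
  obtains v where "v \<in> A" "yosida (3/2 * s) x v"
proof -
  have "norm u \<le> 1"
    using yosida_firmly_nonexpansive[OF x u(2,3)] by (rule firmly_nonexpansive_norm)
  then have "norm ((- 1/2) *\<^sub>R u) < 1" by simp
  then obtain v where v: "v \<in> A" "v = (3/2) *\<^sub>R u + (((- 1/2) *\<^sub>R u) o\<^sub>L v)"
    using affine_fixpoint[OF A, of "(- 1/2) *\<^sub>R u" "(3/2) *\<^sub>R u"] operator_algebra_scaleR[OF A u(1)]
    by blast
  have "yosida (3/2 * s) x v"
    unfolding yosida_def
  proof (rule blinfun_eqI)
    fix \<xi>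
    have u_apply: "u \<zeta> + s *\<^sub>R x (u \<zeta>) = s *\<^sub>R x \<zeta>" for \<zeta>
      using arg_cong[OF u(2)[unfolded yosida_def], of "\<lambda>T. T \<zeta>"]
      by (simp add: blinfun.bilinear_simps)
    have "v \<xi> = ((3/2) *\<^sub>R u + (((- 1/2) *\<^sub>R u) o\<^sub>L v)) \<xi>"
      using v(2) by (rule arg_cong)
    then have v_apply: "v \<xi> + (1/2) *\<^sub>R u (v \<xi>) = (3/2) *\<^sub>R u \<xi>"
      by (simp add: blinfun.bilinear_simps eq_diff_eq)
    have "v \<xi> + (3/2 * s) *\<^sub>R x (v \<xi>)
        = v \<xi> + s *\<^sub>R x (v \<xi>) + (1/2) *\<^sub>R (s *\<^sub>R x (v \<xi>))"
      by (simp flip: scaleR_add_left add: add.assoc)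
    also have "\<dots> = (v \<xi> + (1/2) *\<^sub>R u (v \<xi>)) + s *\<^sub>R x (v \<xi> + (1/2) *\<^sub>R u (v \<xi>))"
      unfolding u_apply[symmetric, of "v \<xi>"]
      by (simp add: blinfun.bilinear_simps scaleR_add_right mult.commute) (rule u_apply)
    also have "\<dots> = (3/2) *\<^sub>R (u \<xi> + s *\<^sub>R x (u \<xi>))"
      unfolding v_apply by (simp add: blinfun.bilinear_simps scaleR_add_right mult.commute)
    also have "\<dots> = (3/2 * s) *\<^sub>R x \<xi>"
      unfolding u_apply by simp
    finally show "(v + (3/2 * s) *\<^sub>R (x o\<^sub>L v)) \<xi> = ((3/2 * s) *\<^sub>R x) \<xi>"
      by (simp add: blinfun.bilinear_simps)
  qed
  with v(1) show ?thesis by (rule that)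
qed

lemma yosida_exists:
  assumes A: "operator_algebra A" and x: "x \<in> A" "accretive_operator x"
  obtains s u where "N \<le> s" "0 < s" "u \<in> A" "yosida s x u"
proof -
  \<comment> \<open>Small enough for the contraction principle to apply directly.\<close>
  define s\<^sub>0 where "s\<^sub>0 = 1 / (norm x + 1)"
  have "0 < s\<^sub>0" by (simp add: s\<^sub>0_def add_nonneg_pos)
  have "norm ((- s\<^sub>0) *\<^sub>R x) < 1"
    by (simp add: s\<^sub>0_def add_nonneg_pos)
  then obtain u where u: "u \<in> A" "u = s\<^sub>0 *\<^sub>R x + (((- s\<^sub>0) *\<^sub>R x) o\<^sub>L u)"
    using affine_fixpoint[OF A, of "(- s\<^sub>0) *\<^sub>R x" "s\<^sub>0 *\<^sub>R x"] operator_algebra_scaleR[OF A x(1)]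
    by blast
  have "yosida s\<^sub>0 x u"
    unfolding yosida_def
  proof (rule blinfun_eqI)
    fix \<xi>
    have "u \<xi> = (s\<^sub>0 *\<^sub>R x + (((- s\<^sub>0) *\<^sub>R x) o\<^sub>L u)) \<xi>"
      using u(2) by (rule arg_cong)
    then show "(u + s\<^sub>0 *\<^sub>R (x o\<^sub>L u)) \<xi> = (s\<^sub>0 *\<^sub>R x) \<xi>"
      by (simp add: blinfun.bilinear_simps eq_diff_eq)
  qed
  have "\<exists>v\<in>A. yosida ((3/2) ^ k * s\<^sub>0) x v" for k
  proof (induction k)
    case 0
    show ?case using u(1) \<open>yosida s\<^sub>0 x u\<close> by auto
  next
    case (Suc k)
    then obtain v where v: "v \<in> A" "yosida ((3/2) ^ k * s\<^sub>0) x v" by blast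
    obtain w where "w \<in> A" "yosida (3/2 * ((3/2) ^ k * s\<^sub>0)) x w"
      by (rule yosida_step[OF A x(2) v]) (use \<open>0 < s\<^sub>0\<close> in simp)
    then show ?case by (auto simp: mult.assoc)
  qed
  moreover obtain k where "N / s\<^sub>0 < (3/2) ^ k"
    using real_arch_pow[of "3/2"] by auto
  then have "N \<le> (3/2) ^ k * s\<^sub>0"
    using \<open>0 < s\<^sub>0\<close> by (simp add: pos_divide_less_eq)
  ultimately show ?thesis
    using that[of "(3/2) ^ k * s\<^sub>0"] \<open>0 < s\<^sub>0\<close> by auto
qed

text \<open>
  For large \<open>s\<close> the operator \<open>u\<close> is a two-sided approximate unit for every firmly nonexpansive \<open>y\<close>
  below \<open>x\<close>.  Positive operators would allow square roots of \<open>y\<close> here; firm nonexpansiveness of \<open>y\<close> and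
  of its adjoint is the substitute, as it bounds \<open>\<parallel>y \<eta>\<parallel>\<^sup>2\<close> and \<open>\<parallel>y* \<eta>\<parallel>\<^sup>2\<close> by the
  quadratic form of \<open>x\<close> at \<open>\<eta>\<close>.
\<close>

lemma yosida_absorbs_dominated:
  fixes x y u :: "'a::{real_inner, complete_space} \<Rightarrow>\<^sub>L 'a"
  assumes x: "accretive_operator x" and u: "yosida s x u" "0 < s"
    and y: "firmly_nonexpansive y" and dom: "\<And>\<xi>. inner (y \<xi>) \<xi> \<le> inner (x \<xi>) \<xi>"
  shows "norm ((u o\<^sub>L y) - y) \<le> 1 / sqrt s" and "norm ((y o\<^sub>L u) - y) \<le> 1 / sqrt s"
proof -
  have u_firm: "firmly_nonexpansive u"
    using yosida_firmly_nonexpansive[OF x u(1)] u(2) by simp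
  have le_sqrt: "norm z \<le> 1 / sqrt s * norm \<xi>" if "s * (norm z)\<^sup>2 \<le> (norm \<xi>)\<^sup>2" for z \<xi> :: 'a
  proof (rule power2_le_imp_le)
    show "(norm z)\<^sup>2 \<le> (1 / sqrt s * norm \<xi>)\<^sup>2"
      using that u(2) by (simp add: power_mult_distrib power_divide field_simps)
  qed (use u(2) in simp)
  show "norm ((y o\<^sub>L u) - y) \<le> 1 / sqrt s"
  proof (rule norm_blinfun_bound)
    fix \<xi>
    define \<eta> where "\<eta> = \<xi> - u \<xi>"
    have "s * (norm (y \<eta>))\<^sup>2 \<le> s * inner (x \<eta>) \<eta>"
      using y dom[of \<eta>] u(2) unfolding firmly_nonexpansive_def
      by (intro mult_left_mono) (auto intro: order_trans)
    also have "\<dots> = inner (u \<xi>) (\<xi> - u \<xi>)"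
      unfolding \<eta>_def by (subst (3) yosida_apply[OF u(1)]) simp
    also have "\<dots> \<le> inner (u \<xi>) \<xi>"
      by (simp add: inner_diff_right)
    also have "\<dots> \<le> norm (u \<xi>) * norm \<xi>" by (rule norm_cauchy_schwarz)
    also have "\<dots> \<le> (norm \<xi>)\<^sup>2"
      using norm_blinfun_le[OF firmly_nonexpansive_norm[OF u_firm], of \<xi>]
      by (simp add: power2_eq_square mult_right_mono)
    finally have "norm (y \<eta>) \<le> 1 / sqrt s * norm \<xi>" by (rule le_sqrt)
    moreover have "((y o\<^sub>L u) - y) \<xi> = - y \<eta>"
      by (simp add: \<eta>_def blinfun.bilinear_simps)
    ultimately show "norm (((y o\<^sub>L u) - y) \<xi>) \<le> 1 / sqrt s * norm \<xi>" by simp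
  qed (use u(2) in simp)
  obtain S where S: "\<And>\<xi> \<eta>. inner (y \<xi>) \<eta> = inner \<xi> (blinfun_apply S \<eta>)"
    using inner_adjoint_exists by blast
  show "norm ((u o\<^sub>L y) - y) \<le> 1 / sqrt s"
  proof (rule norm_blinfun_bound)
    fix \<xi>
    define \<zeta> where "\<zeta> = y \<xi> - u (y \<xi>)"
    define \<rho> where "\<rho> = norm (S \<zeta>)"
    have "y \<xi> = \<zeta> + s *\<^sub>R x \<zeta>"
      using yosida_apply[OF u(1), of "y \<xi>"] by (simp add: \<zeta>_def algebra_simps)
    then have "inner (y \<xi>) \<zeta> = (norm \<zeta>)\<^sup>2 + s * inner (x \<zeta>) \<zeta>"
      by (simp add: inner_simps power2_norm_eq_inner)
    moreover have "s * \<rho>\<^sup>2 \<le> s * inner (x \<zeta>) \<zeta>"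
    proof -
      have "\<rho>\<^sup>2 \<le> inner (S \<zeta>) \<zeta>"
        using firmly_nonexpansive_adjoint[OF y S] by (simp add: firmly_nonexpansive_def \<rho>_def)
      also have "\<dots> = inner (y \<zeta>) \<zeta>" using S[of \<zeta> \<zeta>] inner_commute[of "S \<zeta>" \<zeta>] by simp
      also have "\<dots> \<le> inner (x \<zeta>) \<zeta>" by (rule dom)
      finally show ?thesis using u(2) by simp
    qed
    moreover have "inner (y \<xi>) \<zeta> \<le> norm \<xi> * \<rho>"
      unfolding S \<rho>_def by (rule norm_cauchy_schwarz)
    ultimately have "(norm \<zeta>)\<^sup>2 \<le> norm \<xi> * \<rho> - s * \<rho>\<^sup>2" by linarith
    then have "s * (norm \<zeta>)\<^sup>2 \<le> s * (norm \<xi> * \<rho> - s * \<rho>\<^sup>2)"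
      using u(2) by simp
    \<comment> \<open>The difference of the two bounds is a sum of squares.\<close>
    also have "\<dots> = (norm \<xi>)\<^sup>2 - ((norm \<xi> - s * \<rho> / 2)\<^sup>2 + 3 / 4 * (s * \<rho>)\<^sup>2)"
      by (simp add: power2_eq_square field_simps)
    also have "\<dots> \<le> (norm \<xi>)\<^sup>2"
      unfolding diff_le_eq by (simp only: le_add_same_cancel1) (intro add_nonneg_nonneg; simp)
    finally have "norm \<zeta> \<le> 1 / sqrt s * norm \<xi>" by (rule le_sqrt)
    moreover have "((u o\<^sub>L y) - y) \<xi> = - \<zeta>"
      by (simp add: \<zeta>_def blinfun.bilinear_simps)
    ultimately show "norm (((u o\<^sub>L y) - y) \<xi>) \<le> 1 / sqrt s * norm \<xi>" by simp
  qed (use u(2) in simp)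
qed

lemma blinfun_apply_sum: "blinfun_apply (\<Sum>i\<in>I. f i) \<xi> = (\<Sum>i\<in>I. blinfun_apply (f i) \<xi>)"
  by (induction I rule: infinite_finite_induct) (auto simp: blinfun.add_left)

text \<open>
  Accretive operators form a cone, so finitely many \<open>y\<close> are dominated by their sum and share an
  approximate unit; this is what makes a directed family out of the local units.
\<close>

lemma accretive_local_unit:
  assumes A: "operator_algebra A"
    and Y: "finite Y" "Y \<subseteq> A" "\<And>y. y \<in> Y \<Longrightarrow> firmly_nonexpansive y" and "0 < \<epsilon>"
  obtains u where "u \<in> A" "accretive_operator u" "norm u \<le> 1"
    "\<And>y. y \<in> Y \<Longrightarrow> norm ((u o\<^sub>L y) - y) < \<epsilon> \<and> norm ((y o\<^sub>L u) - y) < \<epsilon>"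
proof -
  define x where "x = \<Sum>Y"
  have nonneg: "0 \<le> inner (y \<xi>) \<xi>" if "y \<in> Y" for y \<xi>
    using firmly_nonexpansive_accretive[OF Y(3)[OF that]] by (simp add: accretive_operator_def)
  have x_inner: "inner (x \<xi>) \<xi> = (\<Sum>y\<in>Y. inner (blinfun_apply y \<xi>) \<xi>)" for \<xi>
    by (simp add: x_def blinfun_apply_sum inner_sum_left)
  have x: "x \<in> A" "accretive_operator x"
    using operator_algebra_sum[OF A Y(1), of "\<lambda>y. y"] Y(2) nonneg
    by (auto simp: x_def[symmetric] accretive_operator_def x_inner sum_nonneg)
  have dom: "inner (y \<xi>) \<xi> \<le> inner (x \<xi>) \<xi>" if "y \<in> Y" for y \<xi>
    unfolding x_inner using that Y(1) nonneg by (intro member_le_sum) auto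
  \<comment> \<open>Any bound above \<open>1 / \<epsilon>\<^sup>2\<close> makes \<open>1 / sqrt s < \<epsilon>\<close> strict.\<close>
  obtain s u where u: "4 / \<epsilon>\<^sup>2 \<le> s" "0 < s" "u \<in> A" "yosida s x u"
    by (rule yosida_exists[OF A x])
  have firm: "firmly_nonexpansive u"
    using yosida_firmly_nonexpansive[OF x(2) u(4)] u(2) by simp
  have "2 / \<epsilon> \<le> sqrt s"
    using u(1) \<open>0 < \<epsilon>\<close> by (intro real_le_rsqrt) (simp add: power_divide)
  then have "1 / sqrt s < \<epsilon>"
    using \<open>0 < \<epsilon>\<close> u(2) by (simp add: field_simps)
  then show ?thesis
    using yosida_absorbs_dominated[OF x(2) u(4,2) Y(3) dom]
    by (intro that[of u] u firmly_nonexpansive_accretive firmly_nonexpansive_norm firm)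
      (auto intro: le_less_trans)
qed

section \<open>The largest approximately unital subalgebra\<close>

definition local_units ::
  "('h::complex_hilbert_space \<Rightarrow>\<^sub>L 'h) set \<Rightarrow> ('h \<Rightarrow>\<^sub>L 'h) set \<Rightarrow> real \<Rightarrow> ('h \<Rightarrow>\<^sub>L 'h) set" where
  "local_units A Y \<epsilon> = {u \<in> A. accretive_operator u \<and> norm u \<le> 1 \<and>
     (\<forall>y\<in>Y. norm ((u o\<^sub>L y) - y) < \<epsilon> \<and> norm ((y o\<^sub>L u) - y) < \<epsilon>)}"

text \<open>
  The sets of local units form a filter base.  The filter plays the role of a contractive
  approximate identity and is available in every operator algebra; if zero is the only accretive
  element of \<open>A\<close>, it converges to zero.
\<close>

definition unit_filter :: "('h::complex_hilbert_space \<Rightarrow>\<^sub>L 'h) set \<Rightarrow> ('h \<Rightarrow>\<^sub>L 'h) filter" where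
  "unit_filter A =
     (INF (Y, \<epsilon>) \<in> {Y. finite Y \<and> Y \<subseteq> {y\<in>A. firmly_nonexpansive y}} \<times> {0<..}.
        principal (local_units A Y \<epsilon>))"

text \<open>
  The elements for which the filter acts as an approximate identity.  With this description,
  being a closed subalgebra and being hereditary are immediate, while maximality and invariance
  follow from the fact that it is also the span of the accretive elements of \<open>A\<close>.
\<close>

definition unital_core :: "('h::complex_hilbert_space \<Rightarrow>\<^sub>L 'h) set \<Rightarrow> ('h \<Rightarrow>\<^sub>L 'h) set" where
  "unital_core A = {a \<in> A. ((\<lambda>e. e o\<^sub>L a) \<longlongrightarrow> a) (unit_filter A) \<and>
                           ((\<lambda>e. a o\<^sub>L e) \<longlongrightarrow> a) (unit_filter A)}"

lemma eventually_unit_filter: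
  "eventually Q (unit_filter A) \<longleftrightarrow>
     (\<exists>Y \<epsilon>. finite Y \<and> Y \<subseteq> {y\<in>A. firmly_nonexpansive y} \<and> 0 < \<epsilon> \<and> (\<forall>u\<in>local_units A Y \<epsilon>. Q u))"
proof -
  let ?B = "{Y. finite Y \<and> Y \<subseteq> {y\<in>A. firmly_nonexpansive y}} \<times> {0<..} :: (_ \<times> real) set"
  let ?F = "\<lambda>(Y, \<epsilon>). principal (local_units A Y \<epsilon>)"
  have "eventually Q (unit_filter A) \<longleftrightarrow> (\<exists>b\<in>?B. eventually Q (?F b))"
    unfolding unit_filter_def
  proof (rule eventually_INF_base)
    show "?B \<noteq> {}" by (auto intro!: exI[of _ "{}"] exI[of _ 1])
    fix p q assume pq: "p \<in> ?B" "q \<in> ?B"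
    obtain Y \<epsilon> Z \<delta> where p: "p = (Y, \<epsilon>)" and q: "q = (Z, \<delta>)" by (metis surj_pair)
    show "\<exists>b\<in>?B. ?F b \<le> inf (?F p) (?F q)"
    proof (rule bexI)
      show "(Y \<union> Z, min \<epsilon> \<delta>) \<in> ?B" using pq by (auto simp: p q)
      show "?F (Y \<union> Z, min \<epsilon> \<delta>) \<le> inf (?F p) (?F q)"
        by (auto simp: p q local_units_def)
    qed
  qed
  then show ?thesis by (auto simp: eventually_principal)
qed

lemma blinfun_compose_assoc: "(a o\<^sub>L b) o\<^sub>L c = a o\<^sub>L (b o\<^sub>L c)"
  by (rule blinfun_eqI) simp

lemma tendsto_compose_right:
  fixes a b c :: "'a::real_normed_vector \<Rightarrow>\<^sub>L 'a"
  assumes "((\<lambda>e. e o\<^sub>L a) \<longlongrightarrow> b) F"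
  shows "((\<lambda>e. e o\<^sub>L (a o\<^sub>L c)) \<longlongrightarrow> b o\<^sub>L c) F"
  unfolding blinfun_compose_assoc[symmetric] using assms tendsto_const
  by (rule bounded_bilinear.tendsto[OF bounded_bilinear_blinfun_compose])

lemma tendsto_compose_left:
  fixes a b c :: "'a::real_normed_vector \<Rightarrow>\<^sub>L 'a"
  assumes "((\<lambda>e. a o\<^sub>L e) \<longlongrightarrow> b) F"
  shows "((\<lambda>e. (c o\<^sub>L a) o\<^sub>L e) \<longlongrightarrow> c o\<^sub>L b) F"
proof -
  have "(\<lambda>e :: 'a \<Rightarrow>\<^sub>L 'a. (c o\<^sub>L a) o\<^sub>L e) = (\<lambda>e. c o\<^sub>L (a o\<^sub>L e))"
    by (rule ext) (rule blinfun_compose_assoc)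
  then show ?thesis
    using bounded_bilinear.tendsto[OF bounded_bilinear_blinfun_compose tendsto_const[of c] assms]
    by (simp only:)
qed

lemma closed_fixed_in_limit:
  fixes L :: "'i \<Rightarrow> 'a::real_normed_vector \<Rightarrow> 'a"
  assumes lin: "\<And>e a b. L e (a - b) = L e a - L e b"
    and contr: "\<forall>\<^sub>F e in F. \<forall>a. norm (L e a) \<le> norm a"
  shows "closed {a. ((\<lambda>e. L e a) \<longlongrightarrow> a) F}"
proof -
  have "((\<lambda>e. L e a) \<longlongrightarrow> a) F" if a: "a \<in> closure {a. ((\<lambda>e. L e a) \<longlongrightarrow> a) F}" for a
  proof (rule tendstoI)
    fix \<epsilon> :: real assume "0 < \<epsilon>"
    then obtain b where b: "((\<lambda>e. L e b) \<longlongrightarrow> b) F" "norm (b - a) < \<epsilon> / 3"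
      using closure_approachable[THEN iffD1, OF a, rule_format, of "\<epsilon> / 3"]
      by (auto simp: dist_norm)
    have "\<forall>\<^sub>F e in F. norm (L e b - b) < \<epsilon> / 3"
      using tendstoD[OF b(1), of "\<epsilon> / 3"] \<open>0 < \<epsilon>\<close> by (simp add: dist_norm)
    with contr show "\<forall>\<^sub>F e in F. dist (L e a) a < \<epsilon>"
    proof eventually_elim
      case (elim e)
      have "norm (L e a - L e b) \<le> norm (b - a)"
        using elim(1)[rule_format, of "a - b"] by (simp add: lin norm_minus_commute)
      moreover have "L e a - a = (L e a - L e b) + (L e b - b) + (b - a)" by simp
      then have "norm (L e a - a) \<le> norm (L e a - L e b) + norm (L e b - b) + norm (b - a)"
        by (metis norm_triangle3)
      ultimately show ?case
        using elim(2) b(2) by (simp add: dist_norm)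
    qed
  qed
  then show ?thesis unfolding closure_subset_eq[symmetric] by blast
qed

context
  fixes A :: "('h::complex_hilbert_space \<Rightarrow>\<^sub>L 'h) set"
  assumes A: "operator_algebra A"
begin

lemma unit_filter_not_bot: "unit_filter A \<noteq> bot"
proof
  assume "unit_filter A = bot"
  then have "eventually (\<lambda>_. False) (unit_filter A)" by simp
  then obtain Y \<epsilon> where Y: "finite Y" "Y \<subseteq> {y\<in>A. firmly_nonexpansive y}" "0 < \<epsilon>"
    "local_units A Y \<epsilon> = {}"
    unfolding eventually_unit_filter by blast
  obtain u where "u \<in> A" "accretive_operator u" "norm u \<le> 1"
    "\<And>y. y \<in> Y \<Longrightarrow> norm ((u o\<^sub>L y) - y) < \<epsilon> \<and> norm ((y o\<^sub>L u) - y) < \<epsilon>"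
    using accretive_local_unit[OF A Y(1) _ _ Y(3)] Y(2) by blast
  then show False using Y(4) by (auto simp: local_units_def)
qed

lemma eventually_unit_filter_contraction:
  "\<forall>\<^sub>F e in unit_filter A. e \<in> A \<and> accretive_operator e \<and> norm e \<le> 1"
  unfolding eventually_unit_filter local_units_def by (auto intro!: exI[of _ "{}"] exI[of _ 1])

lemma firmly_nonexpansive_in_unital_core:
  assumes "y \<in> A" "firmly_nonexpansive y"
  shows "y \<in> unital_core A"
proof -
  have close: "\<forall>\<^sub>F e in unit_filter A. norm ((e o\<^sub>L y) - y) < \<epsilon> \<and> norm ((y o\<^sub>L e) - y) < \<epsilon>"
    if "0 < \<epsilon>" for \<epsilon>
    unfolding eventually_unit_filter using assms that
    by (intro exI[of _ "{y}"] exI[of _ \<epsilon>]) (auto simp: local_units_def)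
  have "((\<lambda>e. e o\<^sub>L y) \<longlongrightarrow> y) (unit_filter A)"
    by (rule tendstoI, unfold dist_norm) (rule eventually_mono[OF close], auto)
  moreover have "((\<lambda>e. y o\<^sub>L e) \<longlongrightarrow> y) (unit_filter A)"
    by (rule tendstoI, unfold dist_norm) (rule eventually_mono[OF close], auto)
  ultimately show ?thesis using assms(1) by (simp add: unital_core_def)
qed

text \<open>
  An accretive \<open>x\<close> factors as \<open>c y = y c\<close> through its Yosida regularization \<open>y\<close>, with \<open>c = 1/s + x\<close>.  As
  \<open>y\<close> is firmly nonexpansive, it is absorbed by the local units, and then so is \<open>x\<close>.
\<close>

lemma accretive_in_unital_core:
  assumes x: "x \<in> A" "accretive_operator x"
  shows "x \<in> unital_core A"
proof -
  obtain s y where y: "0 < s" "y \<in> A" "yosida s x y"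
    by (rule yosida_exists[OF A x, of 0])
  have "firmly_nonexpansive y"
    using yosida_firmly_nonexpansive[OF x(2) y(3)] y(1) by simp
  then have y_core: "((\<lambda>e. e o\<^sub>L y) \<longlongrightarrow> y) (unit_filter A)" "((\<lambda>e. y o\<^sub>L e) \<longlongrightarrow> y) (unit_filter A)"
    using firmly_nonexpansive_in_unital_core[OF y(2)] by (auto simp: unital_core_def)
  let ?c = "(1 / s) *\<^sub>R id_blinfun + x"
  have right: "x = ?c o\<^sub>L y"
  proof (rule blinfun_eqI)
    fix \<xi>
    have "(1 / s) *\<^sub>R y \<xi> = (1 / s) *\<^sub>R (s *\<^sub>R x (\<xi> - y \<xi>))"
      using yosida_apply[OF y(3)] by (rule arg_cong)
    then show "x \<xi> = (?c o\<^sub>L y) \<xi>"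
      using y(1) by (simp add: blinfun.bilinear_simps)
  qed
  have left: "x = y o\<^sub>L ?c"
  proof (rule blinfun_eqI)
    fix \<xi>
    have "y (x \<xi>) = x (y \<xi>)"
      using yosida_commute[OF x(2) y(3)] y(1) by (metis blinfun_apply_blinfun_compose less_imp_le)
    then show "x \<xi> = (y o\<^sub>L ?c) \<xi>"
      using arg_cong[OF right, of "\<lambda>T. T \<xi>"] by (simp add: blinfun.bilinear_simps)
  qed
  have "((\<lambda>e. e o\<^sub>L x) \<longlongrightarrow> x) (unit_filter A)"
    using tendsto_compose_right[OF y_core(1), of ?c] by (simp only: left[symmetric])
  moreover have "((\<lambda>e. x o\<^sub>L e) \<longlongrightarrow> x) (unit_filter A)"
    using tendsto_compose_left[OF y_core(2), of ?c] by (simp only: right[symmetric])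
  ultimately show ?thesis using x(1) by (simp add: unital_core_def)
qed

lemma operator_algebra_unital_core: "operator_algebra (unital_core A)"
proof -
  let ?F = "unit_filter A"
  have bounded: "T \<in> bounded_operators" if "T \<in> A" for T
    using A that by (auto simp: operator_algebra_def)
  have "closed (unital_core A)"
  proof -
    have "\<forall>\<^sub>F e in ?F. \<forall>a :: 'h \<Rightarrow>\<^sub>L 'h. norm (e o\<^sub>L a) \<le> norm a"
      using eventually_unit_filter_contraction
    proof eventually_elim
      case (elim e)
      have "norm (e o\<^sub>L a) \<le> norm a" for a :: "'h \<Rightarrow>\<^sub>L 'h"
        using order_trans[OF norm_blinfun_compose mult_right_mono, of e 1 a] elim by simp
      then show ?case by blast
    qed
    then have 1: "closed {a :: 'h \<Rightarrow>\<^sub>L 'h. ((\<lambda>e. e o\<^sub>L a) \<longlongrightarrow> a) ?F}"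
      by (intro closed_fixed_in_limit)
        (auto simp: bounded_bilinear.diff_right[OF bounded_bilinear_blinfun_compose])
    have "\<forall>\<^sub>F e in ?F. \<forall>a :: 'h \<Rightarrow>\<^sub>L 'h. norm (a o\<^sub>L e) \<le> norm a"
      using eventually_unit_filter_contraction
    proof eventually_elim
      case (elim e)
      have "norm (a o\<^sub>L e) \<le> norm a" for a :: "'h \<Rightarrow>\<^sub>L 'h"
        using order_trans[OF norm_blinfun_compose mult_left_mono, of e 1 a] elim by simp
      then show ?case by blast
    qed
    then have 2: "closed {a :: 'h \<Rightarrow>\<^sub>L 'h. ((\<lambda>e. a o\<^sub>L e) \<longlongrightarrow> a) ?F}"
      by (intro closed_fixed_in_limit)
        (auto simp: bounded_bilinear.diff_left[OF bounded_bilinear_blinfun_compose])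
    have "unital_core A =
        A \<inter> ({a. ((\<lambda>e. e o\<^sub>L a) \<longlongrightarrow> a) ?F} \<inter> {a. ((\<lambda>e. a o\<^sub>L e) \<longlongrightarrow> a) ?F})"
      by (auto simp: unital_core_def)
    then show ?thesis
      using closed_Int[OF operator_algebra_closed[OF A] closed_Int[OF 1 2]] by (simp only:)
  qed
  moreover have "S + T \<in> unital_core A" if "S \<in> unital_core A" "T \<in> unital_core A" for S T
  proof -
    have "((\<lambda>e. e o\<^sub>L (S + T)) \<longlongrightarrow> S + T) ?F"
      unfolding bounded_bilinear.add_right[OF bounded_bilinear_blinfun_compose]
      using that by (intro tendsto_add) (simp_all add: unital_core_def)
    moreover have "((\<lambda>e. (S o\<^sub>L e) + (T o\<^sub>L e)) \<longlongrightarrow> S + T) ?F"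
      using that by (intro tendsto_add) (simp_all add: unital_core_def)
    then have "((\<lambda>e. (S + T) o\<^sub>L e) \<longlongrightarrow> S + T) ?F"
      by (simp only: bounded_bilinear.add_left[OF bounded_bilinear_blinfun_compose, symmetric])
    moreover have "S + T \<in> A"
      using that by (intro operator_algebra_add[OF A]) (auto simp: unital_core_def)
    ultimately show ?thesis by (simp add: unital_core_def)
  qed
  moreover have "scaleC_op c T \<in> unital_core A" if T: "T \<in> unital_core A" for c T
  proof -
    have "T \<in> A" using T by (simp add: unital_core_def)
    \<comment> \<open>Complex scalars commute with \<open>T\<close> and may be placed on the side away from the filter variable.\<close>
    then have eq: "scaleC_op c T = T o\<^sub>L scaleC_op c id_blinfun"
      using bounded by (intro blinfun_eqI) (auto simp: scaleC_op.rep_eq bounded_operators_def)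
    have eq': "scaleC_op c T = scaleC_op c id_blinfun o\<^sub>L T"
      by (intro blinfun_eqI) (auto simp: scaleC_op.rep_eq)
    have "((\<lambda>e. e o\<^sub>L scaleC_op c T) \<longlongrightarrow> scaleC_op c T) ?F"
      unfolding eq using T by (intro tendsto_compose_right) (simp add: unital_core_def)
    moreover have "((\<lambda>e. scaleC_op c T o\<^sub>L e) \<longlongrightarrow> scaleC_op c T) ?F"
      unfolding eq' using T by (intro tendsto_compose_left) (simp add: unital_core_def)
    ultimately show ?thesis
      using A \<open>T \<in> A\<close> by (auto simp: unital_core_def operator_algebra_def)
  qed
  moreover have "S o\<^sub>L T \<in> unital_core A" if "S \<in> unital_core A" "T \<in> unital_core A" for S T
  proof -
    have "((\<lambda>e. e o\<^sub>L (S o\<^sub>L T)) \<longlongrightarrow> S o\<^sub>L T) ?F"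
      using that(1) by (intro tendsto_compose_right) (simp add: unital_core_def)
    moreover have "((\<lambda>e. (S o\<^sub>L T) o\<^sub>L e) \<longlongrightarrow> S o\<^sub>L T) ?F"
      using that(2) by (intro tendsto_compose_left) (simp add: unital_core_def)
    moreover have "S o\<^sub>L T \<in> A"
      using that by (intro operator_algebra_compose[OF A]) (auto simp: unital_core_def)
    ultimately show ?thesis by (simp add: unital_core_def)
  qed
  moreover have "0 \<in> unital_core A"
    using operator_algebra_zero[OF A] by (simp add: unital_core_def)
  moreover have "unital_core A \<subseteq> bounded_operators"
    using bounded by (auto simp: unital_core_def)
  ultimately show ?thesis unfolding operator_algebra_def by blast
qed

lemma approximately_unital_subalgebra_unital_core:
  "approximately_unital_subalgebra A (unital_core A)"
proof -
  have "\<forall>\<^sub>F e in unit_filter A. e \<in> unital_core A \<and> norm e \<le> 1"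
    using eventually_unit_filter_contraction
    by (rule eventually_mono) (auto intro: accretive_in_unital_core)
  then have "approximately_unital (unital_core A)"
    unfolding approximately_unital_def using unit_filter_not_bot
    by (intro exI[of _ "unit_filter A"]) (auto simp: unital_core_def)
  then show ?thesis
    using operator_algebra_unital_core
    by (auto simp: approximately_unital_subalgebra_def unital_core_def)
qed

lemma hereditary_subalgebra_unital_core: "hereditary_subalgebra A (unital_core A)"
proof -
  have "d o\<^sub>L a o\<^sub>L e \<in> unital_core A" if "d \<in> unital_core A" "a \<in> A" "e \<in> unital_core A" for d a e
  proof -
    have assoc: "d o\<^sub>L a o\<^sub>L e = d o\<^sub>L (a o\<^sub>L e)" by (rule blinfun_eqI) simp
    have "((\<lambda>u. u o\<^sub>L (d o\<^sub>L (a o\<^sub>L e))) \<longlongrightarrow> d o\<^sub>L (a o\<^sub>L e)) (unit_filter A)"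
      using that(1) by (intro tendsto_compose_right) (simp add: unital_core_def)
    moreover have "((\<lambda>u. d o\<^sub>L a o\<^sub>L e o\<^sub>L u) \<longlongrightarrow> d o\<^sub>L a o\<^sub>L e) (unit_filter A)"
      using that(3) by (intro tendsto_compose_left) (simp add: unital_core_def)
    moreover have "d o\<^sub>L a o\<^sub>L e \<in> A"
      using that by (intro operator_algebra_compose[OF A]) (auto simp: unital_core_def)
    ultimately show ?thesis by (simp add: unital_core_def assoc)
  qed
  then show ?thesis
    using approximately_unital_subalgebra_unital_core by (auto simp: hereditary_subalgebra_def)
qed

lemma approximately_unital_subalgebra_le_unital_core:
  assumes "approximately_unital_subalgebra A E"
  shows "E \<subseteq> unital_core A"
proof
  fix a assume "a \<in> E"
  have E: "E \<subseteq> A" "operator_algebra E" "approximately_unital E"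
    using assms by (auto simp: approximately_unital_subalgebra_def)
  obtain x y where xy: "x \<in> E" "y \<in> E" "accretive_operator x" "accretive_operator y" "a = x - y"
    by (rule accretive_decomposition[OF E(2,3) \<open>a \<in> E\<close>])
  show "a \<in> unital_core A"
    unfolding xy(5) using xy E(1)
    by (intro operator_algebra_diff[OF operator_algebra_unital_core] accretive_in_unital_core) auto
qed

lemma largest_unital_core: "largest_approximately_unital_subalgebra A (unital_core A)"
  using approximately_unital_subalgebra_unital_core approximately_unital_subalgebra_le_unital_core
  by (auto simp: largest_approximately_unital_subalgebra_def)

text \<open>
  The core is spanned by accretive elements, and conversely every accretive element of \<open>A\<close> lies in it;
  hence a map that preserves accretivity preserves the core.
\<close>

lemma real_completely_positive_preserves_unital_core:
  assumes P: "real_completely_positive A P"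
  shows "P ` unital_core A \<subseteq> unital_core A"
proof clarify
  fix a assume "a \<in> unital_core A"
  have D: "unital_core A \<subseteq> A" "approximately_unital (unital_core A)"
    using approximately_unital_subalgebra_unital_core
    by (auto simp: approximately_unital_subalgebra_def)
  obtain x y where xy: "x \<in> unital_core A" "y \<in> unital_core A"
    "accretive_operator x" "accretive_operator y" "a = x - y"
    by (rule accretive_decomposition[OF operator_algebra_unital_core D(2) \<open>a \<in> unital_core A\<close>])
  have map: "map_on A P" and bounded: "A \<subseteq> bounded_operators"
    using P A by (auto simp: real_completely_positive_def operator_algebra_def)
  have in_core: "P z \<in> unital_core A" if "z \<in> unital_core A" "accretive_operator z" for z
    using that D(1) map real_completely_positive_imp_accretive[OF P bounded]
    by (intro accretive_in_unital_core) (auto simp: map_on_def)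
  have "x = a + y" by (simp add: xy(5))
  moreover have "a \<in> A" "y \<in> A"
    using \<open>a \<in> unital_core A\<close> xy(2) D(1) by auto
  ultimately have "P x = P a + P y" using map by (simp add: map_on_def)
  then have "P a = P x - P y" by simp
  then show "P a \<in> unital_core A"
    using in_core xy operator_algebra_diff[OF operator_algebra_unital_core] by simp
qed

end

section \<open>Restriction to an invariant subalgebra\<close>

lemma matrix_apply_cong:
  assumes "\<And>i j. i < n \<Longrightarrow> j < n \<Longrightarrow> x i j = y i j" "i < n"
  shows "matrix_apply n x \<xi> i = matrix_apply n y \<xi> i"
  unfolding matrix_apply_def using assms by (intro sum.cong) auto

lemma matrix_norm_cong:
  assumes "\<And>i j. i < n \<Longrightarrow> j < n \<Longrightarrow> x i j = y i j"
  shows "matrix_norm n x = matrix_norm n y"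
  unfolding matrix_norm_def using matrix_apply_cong[of n x y] assms
  by (intro SUP_cong refl L2_set_cong) auto

lemma matrix_nonneg_cong:
  assumes "\<And>i j. i < n \<Longrightarrow> j < n \<Longrightarrow> x i j = y i j"
  shows "matrix_nonneg n x = matrix_nonneg n y"
  unfolding matrix_nonneg_def using matrix_apply_cong[of n x y] assms by simp

text \<open>
  The matrix norms of the operator space \<open>D\<close> are those of \<open>A\<close>, so passing to \<open>D\<close> only shrinks the set
  over which the supremum is taken.
\<close>

lemma cb_norm_subset:
  assumes "D \<subseteq> A" "\<And>T. T \<in> D \<Longrightarrow> Q T = P T"
  shows "cb_norm D Q \<le> cb_norm A P"
  unfolding cb_norm_def
proof (rule SUP_mono, rule bexI, rule SUP_mono)
  fix n x
  assume x: "x \<in> {x \<in> matrices n D. matrix_norm n x \<le> 1}"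
  then have "x \<in> {x \<in> matrices n A. matrix_norm n x \<le> 1}"
    using assms(1) by (auto simp: matrices_def)
  moreover have "matrix_norm n (amplification Q x) = matrix_norm n (amplification P x)"
    using x assms(2) by (intro matrix_norm_cong) (auto simp: amplification_def matrices_def)
  ultimately show "\<exists>y\<in>{x \<in> matrices n A. matrix_norm n x \<le> 1}.
      ennreal (matrix_norm n (amplification Q x)) \<le> ennreal (matrix_norm n (amplification P y))"
    by (intro bexI[of _ x]) simp_all
qed simp

context
  fixes A D :: "('h::complex_hilbert_space \<Rightarrow>\<^sub>L 'h) set" and P
  assumes D: "D \<subseteq> A" "operator_algebra D" and inv: "P ` D \<subseteq> D"
begin

lemma map_on_restrict: "map_on A P \<Longrightarrow> map_on D (restrict P D)"
  using D inv unfolding map_on_def operator_algebra_def by (auto simp: subset_iff)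

lemma projection_on_restrict: "projection_on A P \<Longrightarrow> projection_on D (restrict P D)"
  using map_on_restrict inv D(1) by (auto simp: projection_on_def image_subset_iff)

lemma completely_contractive_restrict:
  "completely_contractive A P \<Longrightarrow> completely_contractive D (restrict P D)"
  using map_on_restrict order_trans[OF cb_norm_subset[OF D(1), of "restrict P D" P]]
  by (simp add: completely_contractive_def)

lemma real_completely_positive_restrict:
  assumes P: "real_completely_positive A P"
  shows "real_completely_positive D (restrict P D)"
  unfolding real_completely_positive_def
proof (intro conjI allI ballI)
  show "map_on D (restrict P D)"
    using P map_on_restrict by (simp add: real_completely_positive_def)
  fix n x assume x: "x \<in> accretive n D"
  then have xD: "x i j \<in> D" if "i < n" "j < n" for i j
    using that by (simp add: accretive_def matrices_def)
  have "x \<in> accretive n A"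
    using x D(1) by (auto simp: accretive_def matrices_def)
  then have "amplification P x \<in> accretive n A"
    using P by (simp add: real_completely_positive_def)
  moreover have "matrix_nonneg n (\<lambda>i j. amplification P x i j + matrix_adjoint (amplification P x) i j)
      = matrix_nonneg n (\<lambda>i j. amplification (restrict P D) x i j
          + matrix_adjoint (amplification (restrict P D) x) i j)"
    using xD by (intro matrix_nonneg_cong) (simp add: amplification_def matrix_adjoint_def)
  ultimately show "amplification (restrict P D) x \<in> accretive n D"
    using xD inv by (auto simp: accretive_def matrices_def amplification_def)
qed

lemma completely_bicontractive_restrict:
  assumes "completely_bicontractive A P"
  shows "completely_bicontractive D (restrict P D)"
proof -
  have "map_on D (restrict P D)"
    using assms map_on_restrict by (simp add: completely_bicontractive_def projection_on_def)
  moreover have "scaleC_op c (S - T) = scaleC_op c S - scaleC_op c T"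
    for c and S T :: "'h \<Rightarrow>\<^sub>L 'h"
  proof (rule blinfun_eqI)
    show "scaleC_op c (S - T) \<xi> = (scaleC_op c S - scaleC_op c T) \<xi>" for \<xi>
      using scaleC_add_right[of c "S \<xi> - T \<xi>" "T \<xi>"]
      by (simp add: scaleC_op.rep_eq blinfun.diff_left)
  qed
  ultimately have "map_on D (\<lambda>T. T - restrict P D T)"
    using operator_algebra_diff[OF D(2)] unfolding map_on_def by simp
  moreover have "cb_norm D (\<lambda>T. T - restrict P D T) \<le> cb_norm A (\<lambda>T. T - P T)"
    using D(1) by (intro cb_norm_subset) auto
  ultimately show ?thesis
    using assms projection_on_restrict completely_contractive_restrict
    by (auto simp: completely_bicontractive_def completely_contractive_def intro: order_trans)
qed

lemma completely_symmetric_restrict: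
  assumes "completely_symmetric A P"
  shows "completely_symmetric D (restrict P D)"
proof -
  have "cb_norm D (\<lambda>T. T - 2 *\<^sub>R restrict P D T) \<le> cb_norm A (\<lambda>T. T - 2 *\<^sub>R P T)"
    using D(1) by (intro cb_norm_subset) auto
  then show ?thesis
    using assms projection_on_restrict by (auto simp: completely_symmetric_def intro: order_trans)
qed

end

theorem proposition2p1:
  fixes A :: "('h::complex_hilbert_space \<Rightarrow>\<^sub>L 'h) set"
    and P :: "('h \<Rightarrow>\<^sub>L 'h) \<Rightarrow> ('h \<Rightarrow>\<^sub>L 'h)"
  assumes "operator_algebra A"
    and "real_completely_positive A P"
    and "completely_contractive A P"
  shows "\<exists>D. largest_approximately_unital_subalgebra A D \<and>
             hereditary_subalgebra A D \<and>
             P ` D \<subseteq> D \<and>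
             real_completely_positive D (restrict P D) \<and>
             completely_contractive D (restrict P D) \<and>
             (projection_on A P \<longrightarrow> projection_on D (restrict P D)) \<and>
             (completely_bicontractive A P \<longrightarrow> completely_bicontractive D (restrict P D)) \<and>
             (completely_symmetric A P \<longrightarrow> completely_symmetric D (restrict P D))"
proof (intro exI conjI impI)
  let ?D = "unital_core A"
  show "largest_approximately_unital_subalgebra A ?D" "hereditary_subalgebra A ?D"
    by (rule largest_unital_core hereditary_subalgebra_unital_core; fact)+
  show inv: "P ` ?D \<subseteq> ?D"
    by (rule real_completely_positive_preserves_unital_core) fact+
  have D: "?D \<subseteq> A" "operator_algebra ?D"
    using approximately_unital_subalgebra_unital_core[OF assms(1)]
    by (auto simp: approximately_unital_subalgebra_def)
  show "real_completely_positive ?D (restrict P ?D)"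
    by (rule real_completely_positive_restrict[OF D inv]) fact
  show "completely_contractive ?D (restrict P ?D)"
    by (rule completely_contractive_restrict[OF D inv]) fact
  show "projection_on ?D (restrict P ?D)" if "projection_on A P"
    using that by (rule projection_on_restrict[OF D inv])
  show "completely_bicontractive ?D (restrict P ?D)" if "completely_bicontractive A P"
    using that by (rule completely_bicontractive_restrict[OF D inv])
  show "completely_symmetric ?D (restrict P ?D)" if "completely_symmetric A P"
    using that by (rule completely_symmetric_restrict[OF D inv])
qed

end
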